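(* Let $a$, $b$, $c$ and $r\geq 5$ be positive integers with $\gcd(c, rab)=1$. (1) If $$ab \geq 2^r\, r^{\frac{182.6\, r}{r-1}},$$ then the equation $a x^r - b y^r = c$ has at most $2\, r^{\omega(c)}$ primitive solutions in positive integers $x$ and $y$. (2) If $$ab\geq 2^r\, r^{7r/(r-4)},$$ then the equation $a x^r - b y^r = c$ has at most $3\, r^{\omega(c)}$ primitive solutions in positive integers $x$ and $y$.
   Context: A solution $(x,y)\in\mathbb{Z}^2$ is called primitive if $\gcd(x,y)=1$. $\omega(c)$ denotes the number of distinct prime factors of $c$. *)

theory Defs
  imports Complex_Main "HOL-Computational_Algebra.Primes"
begin

definition omega :: "nat \<Rightarrow> nat" where
  "omega c = card (prime_factors c)"

definition primitive :: "int \<times> int \<Rightarrow> bool" where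
  "primitive p \<longleftrightarrow> gcd (fst p) (snd p) = 1"

text \<open>The equation \<open>a x^r - b y^r = c\<close> is read over the integers, so that the
  subtraction is not truncated.\<close>

definition primitive_positive_solutions ::
    "nat \<Rightarrow> nat \<Rightarrow> nat \<Rightarrow> nat \<Rightarrow> (int \<times> int) set" where
  "primitive_positive_solutions a b c r =
     {(x, y). 0 < x \<and> 0 < y \<and> primitive (x, y) \<and>
              int a * x ^ r - int b * y ^ r = int c}"

text \<open>Finiteness has to be required explicitly because \<open>card\<close> is \<open>0\<close> on infinite sets.\<close>

definition at_most :: "'a set \<Rightarrow> nat \<Rightarrow> bool" where
  "at_most S n \<longleftrightarrow> finite S \<and> card S \<le> n"

end

theory Submission
  imports Defs "HOL-Analysis.Generalised_Binomial_Theorem"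
    "HOL-Computational_Algebra.Polynomial_FPS"
begin

text \<open>
  Write \<open>X = a^(1/r) x\<close>, \<open>Y = b^(1/r) y\<close> and \<open>M = (a b)^(1/r)\<close>, so that a solution satisfies \<open>X^r - Y^r = c\<close>.
  The proof sorts the solutions into at most \<open>r ^ omega c\<close> residue classes and shows that no class
  contains three of them.

  The classes. Modulo a prime \<open>p\<close> dividing \<open>c\<close>, the quotient \<open>x/y\<close> is one of the at most \<open>r\<close> roots of
  \<open>a t^r = b\<close>. Since \<open>p\<close> does not divide \<open>r a b\<close>, these roots lift uniquely, so two solutions with the
  same residues at all such \<open>p\<close> are congruent in the sense that \<open>c\<close> divides \<open>x1 y2 - x2 y1\<close>
  (\<open>congruent_mod_prime_factors_imp_congruent\<close>).

  Gaps. In every solution \<open>X - Y\<close> is at most \<open>c / X^(r-1)\<close>. For two different congruent solutions the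
  integer \<open>x1 y2 - x2 y1\<close> has absolute value at least \<open>c\<close>; here \<open>c\<close> cancels, and what remains is
  \<open>X2 \<ge> M X1^(r-1)\<close> (\<open>gap_principle_real\<close>). As \<open>X1^r > c\<close>, the second solution of a class already has
  \<open>X2^r \<ge> M^r c^(r-1)\<close>.

  Approximation. Put \<open>z = c / X2^r\<close>, which is now very small, and \<open>v = 1/r\<close>. Then
  \<open>(1 - z)^v = Y2 / X2\<close>, so the diagonal Pade approximants of \<open>(1 - z)^v\<close> turn the second solution into
  a sequence of very good rational approximations of \<open>(b/a)^(1/r)\<close>, while a third solution gives
  another one. Comparing the two leads to the integers \<open>N = x2 P y3 - y2 Q x3\<close>, where \<open>P\<close>, \<open>Q\<close> are the
  numerator and denominator of the \<open>n\<close>-th approximant after clearing denominators. Three facts are used: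
  the factor \<open>r^(2n)\<close> suffices to clear them (\<open>rational_gbinomial_denominator\<close>); \<open>P\<close> and \<open>Q\<close> are
  congruent modulo \<open>c\<close> (\<open>pade_homogenised\<close>), so that \<open>c\<close> divides \<open>N\<close>
  along with \<open>x2 y3 - x3 y2\<close>; and \<open>N\<close> does not vanish for two consecutive values of \<open>n\<close> (\<open>pade_determinant\<close>). A nonzero \<open>N\<close> bounds \<open>M\<close> by two explicit terms, the first
  proportional to \<open>X3\<close> and the second to \<open>X3^(1-r)\<close> (\<open>hypergeometric_inequality\<close>). With \<open>n\<close> minimal such
  that the first term is below \<open>M/2\<close>, the second one is below \<open>M/2\<close> as well provided that
  \<open>M^(r-3) \<ge> 256 r^4\<close> (\<open>sizes_contradict_approximation_inequalities\<close>), a contradiction.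
  Both lower bounds on \<open>a b\<close> in the theorem imply that inequality.
\<close>

section \<open>Residue classes of solutions\<close>

text \<open>
  Lagrange's bound: if \<open>t0\<close> is a root modulo \<open>p\<close>, then up to a multiple of \<open>p\<close> the value of \<open>P\<close> at \<open>t\<close> is
  \<open>t - t0\<close> times a polynomial of smaller degree with the same leading coefficient.
\<close>

lemma card_poly_roots_mod_prime_le_degree:
  fixes P :: "int poly" and p :: nat
  assumes p: "prime p" and "\<not> int p dvd lead_coeff P"
  shows "card {t. t < p \<and> int p dvd poly P (int t)} \<le> degree P"
  using assms(2)
proof (induction "degree P" arbitrary: P)
  case 0
  then obtain k where "P = [:k:]" by (metis degree_eq_zeroE)
  with 0 show ?case by simp
next
  case (Suc d)
  show ?case
  proof (cases "{t. t < p \<and> int p dvd poly P (int t)} = {}")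
    case False
    then obtain t0 where t0: "t0 < p" "int p dvd poly P (int t0)" by blast
    define Q where "Q = synthetic_div P (int t0)"
    have P: "[:- int t0, 1:] * Q + [:poly P (int t0):] = P"
      unfolding Q_def by (rule synthetic_div_correct')
    have dQ: "degree Q = d" using Suc.hyps(2) by (simp add: Q_def degree_synthetic_div)
    have "coeff P (Suc d) = coeff Q d"
    proof -
      have "coeff P (Suc d) = coeff ([:- int t0, 1:] * Q + [:poly P (int t0):]) (Suc d)"
        using P by simp
      also have "\<dots> = coeff Q d" using dQ by (simp add: coeff_eq_0)
      finally show ?thesis .
    qed
    then have "\<not> int p dvd lead_coeff Q" using Suc.prems Suc.hyps(2) dQ by simp
    then have IH: "card {t. t < p \<and> int p dvd poly Q (int t)} \<le> d"
      using Suc.hyps(1)[of Q] dQ by simp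
    have "{t. t < p \<and> int p dvd poly P (int t)} \<subseteq> insert t0 {t. t < p \<and> int p dvd poly Q (int t)}"
    proof
      fix t assume "t \<in> {t. t < p \<and> int p dvd poly P (int t)}"
      then have t: "t < p" "int p dvd poly P (int t)" by auto
      have "poly P (int t) = (int t - int t0) * poly Q (int t) + poly P (int t0)"
        by (subst P[symmetric]) (simp add: algebra_simps)
      then have "int p dvd (int t - int t0) * poly Q (int t)"
        using t(2) t0(2) by (metis dvd_add_left_iff)
      then consider "int p dvd int t - int t0" | "int p dvd poly Q (int t)"
        using p prime_dvd_multD[of "int p"] by auto
      then show "t \<in> insert t0 {t. t < p \<and> int p dvd poly Q (int t)}"
      proof cases
        case 1
        then have "int t mod int p = int t0 mod int p" by (simp add: mod_eq_dvd_iff)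
        then show ?thesis using t(1) t0(1) by simp
      qed (use t in auto)
    qed
    then have "card {t. t < p \<and> int p dvd poly P (int t)}
        \<le> card (insert t0 {t. t < p \<and> int p dvd poly Q (int t)})"
      by (intro card_mono) auto
    also have "\<dots> \<le> Suc d" using IH by (intro card_insert_le_m1) auto
    finally show ?thesis using Suc.hyps(2) by simp
  next
    case True then show ?thesis by (simp only: card.empty le0)
  qed
qed

text \<open>
  If \<open>p\<close> divided one of \<open>x\<close>, \<open>y\<close>, the equation would force it to divide the other one too, because \<open>p\<close>
  is prime to \<open>a b\<close>.
\<close>

lemma prime_factor_not_dvd_solution:
  fixes a b c r p :: nat and x y :: int
  assumes "gcd c (r * a * b) = 1" and "(x, y) \<in> primitive_positive_solutions a b c r"
    and p: "prime p" "p dvd c" and r: "r > 0"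
  shows "\<not> int p dvd x" "\<not> int p dvd y" "\<not> p dvd a" "\<not> p dvd b" "\<not> p dvd r"
proof -
  have nd: "\<not> p dvd r * a * b"
    using assms(1) p by (metis coprime_common_divisor_nat coprime_iff_gcd_eq_1 not_prime_1)
  then show nda: "\<not> p dvd a" and ndb: "\<not> p dvd b" and "\<not> p dvd r" by auto
  have eq: "int a * x ^ r - int b * y ^ r = int c" and g: "gcd x y = 1"
    using assms(2) by (auto simp: primitive_positive_solutions_def primitive_def)
  have pc: "int p dvd int c" using p by simp
  have pp: "prime (int p)" using p by simp
  have "int p dvd x \<longleftrightarrow> int p dvd y"
  proof
    assume "int p dvd x"
    then have "int p dvd int a * x ^ r" using r by (intro dvd_mult) (auto intro: dvd_trans[OF _ dvd_power])
    moreover have "int b * y ^ r = int a * x ^ r - int c" using eq by simp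
    ultimately have "int p dvd int b * y ^ r" using pc by simp
    then show "int p dvd y"
      using pp ndb by (metis int_dvd_int_iff prime_dvd_multD prime_dvd_power)
  next
    assume "int p dvd y"
    then have "int p dvd int b * y ^ r" using r by (intro dvd_mult) (auto intro: dvd_trans[OF _ dvd_power])
    moreover have "int a * x ^ r = int b * y ^ r + int c" using eq by simp
    ultimately have "int p dvd int a * x ^ r" using pc by simp
    then show "int p dvd x"
      using pp nda by (metis int_dvd_int_iff prime_dvd_multD prime_dvd_power)
  qed
  moreover have "\<not> (int p dvd x \<and> int p dvd y)"
    using g pp by (metis gcd_greatest not_prime_unit)
  ultimately show "\<not> int p dvd x" "\<not> int p dvd y" by auto
qed

text \<open>
  A form of Hensel's lemma that handles all prime powers at once. With \<open>u = x1 y2\<close> and \<open>v = x2 y1\<close> the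
  equation gives that \<open>c\<close> divides \<open>u^r - v^r = (u - v) G\<close>. Modulo a prime \<open>p\<close> dividing \<open>c\<close> we have \<open>u = v\<close>,
  hence \<open>G = r u^(r-1)\<close>, which is a unit; so \<open>G\<close> is prime to \<open>c\<close>.
\<close>

lemma congruent_mod_prime_factors_imp_congruent:
  fixes a b c r :: nat and x1 y1 x2 y2 :: int
  assumes cop: "gcd c (r * a * b) = 1" and r: "r > 0" and c: "c > 0"
    and s1: "(x1, y1) \<in> primitive_positive_solutions a b c r"
    and s2: "(x2, y2) \<in> primitive_positive_solutions a b c r"
    and cl: "\<And>p. p \<in> prime_factors c \<Longrightarrow> int p dvd x1 * y2 - x2 * y1"
  shows "int c dvd x1 * y2 - x2 * y1"
proof -
  define u v where "u = x1 * y2" and "v = x2 * y1"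
  define G where "G = (\<Sum>i<r. v ^ (r - Suc i) * u ^ i)"
  have fac: "u ^ r - v ^ r = (u - v) * G"
    unfolding G_def by (rule power_diff_sumr2)
  have e1: "int a * x1 ^ r = int c + int b * y1 ^ r" and e2: "int a * x2 ^ r = int c + int b * y2 ^ r"
    using s1 s2 by (auto simp: primitive_positive_solutions_def)
  have "int a * (u ^ r - v ^ r) = (int a * x1 ^ r) * y2 ^ r - (int a * x2 ^ r) * y1 ^ r"
    by (simp add: u_def v_def power_mult_distrib algebra_simps)
  also have "\<dots> = int c * (y2 ^ r - y1 ^ r)" unfolding e1 e2 by (simp add: algebra_simps)
  finally have "int c dvd int a * (u ^ r - v ^ r)" by simp
  moreover have "coprime (int c) (int a)"
  proof -
    have "coprime c (r * a * b)" using cop by (simp add: coprime_iff_gcd_eq_1)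
    then show ?thesis by (simp add: coprime_int_iff)
  qed
  ultimately have "int c dvd (u - v) * G" unfolding fac[symmetric]
    by (simp add: coprime_dvd_mult_right_iff)
  moreover have "coprime (int c) G"
  proof (rule ccontr)
    assume "\<not> coprime (int c) G"
    then have "gcd (int c) G \<noteq> 0" "\<not> is_unit (gcd (int c) G)"
      using c by (auto simp: coprime_iff_gcd_eq_1)
    then obtain q where q: "q dvd gcd (int c) G" "prime q"
      using prime_divisor_exists by blast
    define p where "p = nat q"
    have pq: "int p = q" using q(2) prime_ge_0_int by (simp add: p_def)
    have p: "prime p" using q(2) pq by (metis prime_int_nat_transfer p_def)
    have pc: "p dvd c" using q(1) pq by (metis dvd_gcdD1 int_dvd_int_iff)
    have pG: "int p dvd G" using q(1) pq by (metis dvd_gcdD2)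
    have pin: "p \<in> prime_factors c" using p pc c by (simp add: in_prime_factors_iff)
    have uv: "int p dvd u - v" using cl[OF pin] by (simp add: u_def v_def)
    note nd1 = prime_factor_not_dvd_solution[OF cop s1 p pc r]
    note nd2 = prime_factor_not_dvd_solution[OF cop s2 p pc r]
    have "G mod int p = (\<Sum>i<r. u ^ (r - 1)) mod int p"
    proof -
      have "(v ^ (r - Suc i) * u ^ i) mod int p = u ^ (r - 1) mod int p" if "i < r" for i
      proof -
        have "v mod int p = u mod int p" using uv by (metis mod_eq_dvd_iff)
        then have "(v ^ (r - Suc i) * u ^ i) mod int p = (u ^ (r - Suc i) * u ^ i) mod int p"
          by (metis mod_mult_left_eq power_mod)
        also have "u ^ (r - Suc i) * u ^ i = u ^ (r - 1)"
          using that by (simp add: power_add[symmetric])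
        finally show ?thesis .
      qed
      then have "(\<Sum>i<r. (v ^ (r - Suc i) * u ^ i) mod int p) = (\<Sum>i<r. u ^ (r - 1) mod int p)"
        by (intro sum.cong) auto
      then show ?thesis unfolding G_def
        by (subst mod_sum_eq[symmetric], subst (2) mod_sum_eq[symmetric]) simp
    qed
    then have "int p dvd int r * u ^ (r - 1)"
      using pG by (simp add: dvd_eq_mod_eq_0)
    moreover have "prime (int p)" using p by simp
    ultimately have "int p dvd u"
      using nd1(5) by (metis int_dvd_int_iff prime_dvd_multD prime_dvd_power)
    then show False using nd1(1) nd2(2) \<open>prime (int p)\<close> unfolding u_def
      by (metis prime_dvd_multD)
  qed
  ultimately show ?thesis by (simp add: coprime_dvd_mult_left_iff u_def v_def)
qed

lemma at_most_if_fibres_have_at_most_two: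
  fixes f :: "'a \<Rightarrow> 'b"
  assumes "finite T" "f ` S \<subseteq> T" "card T \<le> n"
    and no3: "\<And>p q s. p \<in> S \<Longrightarrow> q \<in> S \<Longrightarrow> s \<in> S \<Longrightarrow> f p = f q \<Longrightarrow> f q = f s \<Longrightarrow>
            p = q \<or> q = s \<or> p = s"
  shows "at_most S (2 * n)"
proof -
  have fib: "finite {s \<in> S. f s = t} \<and> card {s \<in> S. f s = t} \<le> 2" for t
  proof (rule ccontr)
    assume no: "\<not> ?thesis"
    have "\<exists>B. B \<subseteq> {s \<in> S. f s = t} \<and> card B = 3 \<and> finite B"
    proof (cases "finite {s \<in> S. f s = t}")
      case True
      with no have "3 \<le> card {s \<in> S. f s = t}" by simp
      then show ?thesis by (meson obtain_subset_with_card_n)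
    next
      case False
      then show ?thesis using infinite_arbitrarily_large by blast
    qed
    then obtain B where B: "B \<subseteq> {s \<in> S. f s = t}" "card B = 3" by blast
    then obtain p q s where "B = {p, q, s}" "p \<noteq> q" "q \<noteq> s" "p \<noteq> s"
      by (auto simp: card_3_iff)
    with B no3[of p q s] show False by auto
  qed
  have S: "S = (\<Union>t\<in>T. {s \<in> S. f s = t})" using assms(2) by auto
  have "finite S" by (subst S) (use fib assms(1) in auto)
  moreover have "card S \<le> (\<Sum>t\<in>T. card {s \<in> S. f s = t})"
    by (subst S) (rule card_UN_le[OF assms(1)])
  moreover have "(\<Sum>t\<in>T. card {s \<in> S. f s = t}) \<le> (\<Sum>t\<in>T. 2)"
    by (rule sum_mono) (use fib in auto)
  ultimately show ?thesis using assms(3) by (simp add: at_most_def)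
qed

text \<open>
  The class of a solution is the family of residues of \<open>x/y\<close> at the primes dividing \<open>c\<close>. Each residue is
  a root of \<open>a t^r - b\<close>, so the classes live in a product of \<open>omega c\<close> sets with at most \<open>r\<close> elements.
\<close>

lemma at_most_if_no_three_congruent_solutions:
  fixes a b c r :: nat
  defines "S \<equiv> primitive_positive_solutions a b c r"
  assumes c: "c > 0" and r: "r > 0" and cop: "gcd c (r * a * b) = 1"
    and no3: "\<And>x1 y1 x2 y2 x3 y3. (x1, y1) \<in> S \<Longrightarrow> (x2, y2) \<in> S \<Longrightarrow> (x3, y3) \<in> S \<Longrightarrow>
        x1 < x2 \<Longrightarrow> x2 < x3 \<Longrightarrow> int c dvd x1 * y2 - x2 * y1 \<Longrightarrow>
        int c dvd x2 * y3 - x3 * y2 \<Longrightarrow> False"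
    and ab: "b > 0"
  shows "at_most S (2 * r ^ omega c)"
proof -
  define R where "R p = {t. t < p \<and> int p dvd poly (monom (int a) r - [:int b:]) (int t)}" for p :: nat
  define res where "res s p = (SOME t. t < p \<and> int p dvd int t * snd s - fst s)"
    for s :: "int \<times> int" and p :: nat
  define cls where "cls s = restrict (res s) (prime_factors c)" for s
  have res: "res (x, y) p < p \<and> int p dvd int (res (x, y) p) * y - x"
    if s: "(x, y) \<in> S" and p: "p \<in> prime_factors c" for x y p
  proof -
    have pp: "prime p" "p dvd c" using p by auto
    have "\<not> int p dvd y" using prime_factor_not_dvd_solution[OF cop s[unfolded S_def] pp r] by simp
    then have "coprime (int p) y" using pp(1) by (simp add: prime_imp_coprime)
    then obtain u v where uv: "u * int p + v * y = 1" by (metis bezout_int coprime_iff_gcd_eq_1)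
    \<comment> \<open>\<open>v\<close> is an inverse of \<open>y\<close> modulo \<open>p\<close>, so \<open>t\<close> represents \<open>x/y\<close>.\<close>
    define t where "t = nat ((v * x) mod int p)"
    have p0: "int p > 0" using pp(1) by (simp add: prime_gt_0_nat)
    have t: "int t = (v * x) mod int p" using p0 by (simp add: t_def)
    have "t < p" using p0 t by (metis of_nat_less_iff pos_mod_bound)
    moreover have "int p dvd int t * y - x"
    proof -
      have "(int t * y) mod int p = (v * x * y) mod int p" unfolding t by (rule mod_mult_left_eq)
      also have "v * x * y = x + int p * (- (u * x))"
      proof -
        have "v * x * y = x * (u * int p + v * y) + int p * (- (u * x))" by (simp add: algebra_simps)
        then show ?thesis by (simp only: uv)
      qed
      also have "(x + int p * (- (u * x))) mod int p = x mod int p" by (rule mod_mult_self2)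
      finally show ?thesis by (simp add: mod_eq_dvd_iff)
    qed
    ultimately have "\<exists>t. t < p \<and> int p dvd int t * snd (x, y) - fst (x, y)" by auto
    from someI_ex[OF this] show ?thesis by (simp add: res_def)
  qed
  have in_R: "res (x, y) p \<in> R p" if s: "(x, y) \<in> S" and p: "p \<in> prime_factors c" for x y p
  proof -
    define t where "t = int (res (x, y) p)"
    have pp: "prime p" "p dvd c" "prime (int p)" using p by auto
    note nd = prime_factor_not_dvd_solution[OF cop s[unfolded S_def] pp(1,2) r]
    have "int p dvd t * y - x" using res[OF s p] by (simp add: t_def)
    also have "t * y - x dvd (t * y) ^ r - x ^ r" by (metis dvd_triv_left power_diff_sumr2)
    finally have d: "int p dvd (t * y) ^ r - x ^ r" .
    have eq: "int a * x ^ r = int c + int b * y ^ r"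
      using s by (auto simp: S_def primitive_positive_solutions_def)
    have "(int a * t ^ r - int b) * y ^ r = int a * ((t * y) ^ r - x ^ r) + int c"
      using eq by (simp add: algebra_simps power_mult_distrib)
    moreover have "int p dvd int a * ((t * y) ^ r - x ^ r) + int c"
      using d pp(2) by simp
    ultimately have "int p dvd (int a * t ^ r - int b) * y ^ r" by simp
    then have "int p dvd int a * t ^ r - int b"
      using nd(2) pp(3) by (metis prime_dvd_multD prime_dvd_power)
    then show ?thesis using res[OF s p] by (simp add: R_def t_def poly_monom)
  qed
  have card_R: "card (R p) \<le> r" if p: "p \<in> prime_factors c" and ne: "S \<noteq> {}" for p
  proof -
    obtain x y where s: "(x, y) \<in> S" using ne by auto
    have pp: "prime p" "p dvd c" using p by auto
    note nd = prime_factor_not_dvd_solution[OF cop s[unfolded S_def] pp(1,2) r]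
    let ?P = "monom (int a) r - [:int b:]"
    have a0: "a \<noteq> 0" using nd by (metis dvd_0_right)
    have "coeff ?P r = int a" using r by (cases r) auto
    moreover have "degree ?P \<le> r"
      by (metis degree_diff_le degree_monom_le degree_pCons_0 le0)
    ultimately have "degree ?P = r" using a0 by (metis le_antisym le_degree of_nat_eq_0_iff)
    then show ?thesis unfolding R_def
      using card_poly_roots_mod_prime_le_degree[OF pp(1), of ?P] nd(3) \<open>coeff ?P r = int a\<close> by simp
  qed
  show ?thesis
  proof (cases "S = {}")
    case True then show ?thesis by (simp add: at_most_def)
  next
    case False
    show ?thesis
    proof (rule at_most_if_fibres_have_at_most_two[of "PiE (prime_factors c) R" cls])
      show "finite (PiE (prime_factors c) R)" by (intro finite_PiE) (auto simp: R_def)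
      show "cls ` S \<subseteq> PiE (prime_factors c) R" using in_R by (auto simp: cls_def)
      have "card (PiE (prime_factors c) R) = (\<Prod>p\<in>prime_factors c. card (R p))"
        by (simp add: card_PiE)
      also have "\<dots> \<le> (\<Prod>p\<in>prime_factors c. r)" using card_R False by (intro prod_mono) auto
      finally show "card (PiE (prime_factors c) R) \<le> r ^ omega c" by (simp add: omega_def)
    next
      have same: "int c dvd x1 * y2 - x2 * y1"
        if s: "(x1, y1) \<in> S" "(x2, y2) \<in> S" and eq: "cls (x1, y1) = cls (x2, y2)" for x1 y1 x2 y2
      proof (rule congruent_mod_prime_factors_imp_congruent[OF cop r c s[unfolded S_def]])
        fix p assume p: "p \<in> prime_factors c"
        define t where "t = int (res (x1, y1) p)"
        have "res (x1, y1) p = res (x2, y2) p" using eq p by (metis cls_def restrict_apply')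
        then have "int p dvd t * y1 - x1" "int p dvd t * y2 - x2"
          using res[OF s(1) p] res[OF s(2) p] by (auto simp: t_def)
        then have "int p dvd (t * y2 - x2) * y1 - (t * y1 - x1) * y2" by simp
        then show "int p dvd x1 * y2 - x2 * y1" by (simp add: algebra_simps)
      qed
      have inj: "y1 = y2" if "(x, y1) \<in> S" "(x, y2) \<in> S" for x y1 y2
      proof -
        have "int a * x ^ r - int b * y1 ^ r = int c" "int a * x ^ r - int b * y2 ^ r = int c"
          and "y1 > 0" "y2 > 0"
          using that by (auto simp: S_def primitive_positive_solutions_def)
        then have "int b * y1 ^ r = int b * y2 ^ r" by linarith
        then have "y1 ^ r = y2 ^ r" using ab by simp
        with \<open>y1 > 0\<close> \<open>y2 > 0\<close> show ?thesis using r by (meson less_imp_le power_eq_imp_eq_base)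
      qed
      have lt: "fst p < fst q \<Longrightarrow> fst q < fst s \<Longrightarrow> p \<in> S \<Longrightarrow> q \<in> S \<Longrightarrow> s \<in> S \<Longrightarrow>
          cls p = cls q \<Longrightarrow> cls q = cls s \<Longrightarrow> False" for p q s
        using no3[of "fst p" "snd p" "fst q" "snd q" "fst s" "snd s"]
          same[of "fst p" "snd p" "fst q" "snd q"] same[of "fst q" "snd q" "fst s" "snd s"] by simp
      fix p q s assume a: "p \<in> S" "q \<in> S" "s \<in> S" "cls p = cls q" "cls q = cls s"
      have "fst p = fst q \<or> fst q = fst s \<or> fst p = fst s"
      proof (rule ccontr)
        assume "\<not> ?thesis"
        then have "fst p < fst q \<and> fst q < fst s \<or> fst p < fst s \<and> fst s < fst q \<or>
          fst q < fst p \<and> fst p < fst s \<or> fst q < fst s \<and> fst s < fst p \<or>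
          fst s < fst p \<and> fst p < fst q \<or> fst s < fst q \<and> fst q < fst p" by linarith
        then show False
          using a lt[of p q s] lt[of p s q] lt[of q p s] lt[of q s p] lt[of s p q] lt[of s q p] by argo
      qed
      then show "p = q \<or> q = s \<or> p = s"
        using a(1-3) inj[of "fst p" "snd p" "snd q"] inj[of "fst q" "snd q" "snd s"]
          inj[of "fst p" "snd p" "snd s"] by (auto simp: prod_eq_iff)
    qed
  qed
qed

section \<open>Denominators of binomial coefficients with rational argument\<close>

text \<open>
  Legendre's argument: only the multiples of \<open>p\<close> contribute, and dividing them by \<open>p\<close> gives
  \<open>n div p + multiplicity p (fact (n div p))\<close>, which by induction is at most \<open>2 (n div p) \<le> n\<close>.
\<close>

lemma multiplicity_fact_le:
  assumes p: "prime (p::nat)"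
  shows "multiplicity p (fact n :: nat) \<le> n"
proof (induction n rule: less_induct)
  case (less n)
  have p2: "p \<ge> 2" using p by (rule prime_ge_2_nat)
  have "multiplicity p (fact n) = multiplicity p (\<Prod>{1..n})" by (simp add: fact_prod)
  also have "\<dots> = (\<Sum>i\<in>{1..n}. multiplicity p i)"
    using p by (subst prime_elem_multiplicity_prod_distrib) auto
  also have "\<dots> = (\<Sum>i\<in>(*) p ` {1..n div p}. multiplicity p i)"
  proof (rule sum.mono_neutral_right)
    show "(*) p ` {1..n div p} \<subseteq> {1..n}"
    proof
      fix i assume "i \<in> (*) p ` {1..n div p}"
      then obtain k where k: "i = p * k" "1 \<le> k" "k \<le> n div p" by (elim imageE) auto
      have "p * k \<le> p * (n div p)" using k by simp
      also have "\<dots> \<le> n" by simp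
      finally show "i \<in> {1..n}" using k p2 by simp
    qed
    show "\<forall>i\<in>{1..n} - (*) p ` {1..n div p}. multiplicity p i = 0"
    proof
      fix i assume i: "i \<in> {1..n} - (*) p ` {1..n div p}"
      have "\<not> p dvd i"
      proof
        assume "p dvd i"
        then obtain k where k: "i = p * k" by auto
        then have "1 \<le> k" "k \<le> n div p" using i p2 by (auto simp: less_eq_div_iff_mult_less_eq mult.commute)
        then show False using i k by auto
      qed
      then show "multiplicity p i = 0" by (rule not_dvd_imp_multiplicity_0)
    qed
  qed auto
  also have "\<dots> = (\<Sum>k\<in>{1..n div p}. multiplicity p (p * k))"
    using p2 by (subst sum.reindex) (auto simp: inj_on_def)
  also have "\<dots> = (\<Sum>k\<in>{1..n div p}. Suc (multiplicity p k))"
    using p by (intro sum.cong) (auto simp: prime_elem_multiplicity_mult_distrib)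
  also have "\<dots> = n div p + multiplicity p (\<Prod>{1..n div p})"
    using p by (subst prime_elem_multiplicity_prod_distrib) (auto simp: sum_Suc)
  also have "\<dots> = n div p + multiplicity p (fact (n div p))" by (simp add: fact_prod)
  also have "\<dots> \<le> n"
  proof (cases "n = 0")
    case False
    have "n div p < n" using False p2 by simp
    then have "multiplicity p (fact (n div p)) \<le> n div p" by (rule less.IH)
    moreover have "2 * (n div p) \<le> p * (n div p)" using p2 by simp
    moreover have "p * (n div p) \<le> n" by simp
    ultimately show ?thesis by linarith
  qed simp
  finally show ?case .
qed

text \<open>
  Compare the powers of each prime \<open>p\<close>. If \<open>p\<close> divides \<open>r\<close>, the factor \<open>r^j\<close> alone is divisible by the
  part of \<open>fact j\<close> at \<open>p\<close>. Otherwise \<open>r\<close> is invertible modulo that part, and with \<open>s = r t\<close>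
  modulo that part the product becomes \<open>r^j\<close> times \<open>t (t-1) ... (t-j+1)\<close>, a multiple of \<open>fact j\<close>.
\<close>

lemma fact_dvd_falling_progression:
  fixes s :: int and r j :: nat
  assumes r: "r > 0"
  shows "(fact j :: int) dvd int r ^ j * (\<Prod>i<j. s - int r * int i)"
proof (cases "(\<Prod>i<j. s - int r * int i) = 0")
  case False
  define P where "P = (\<Prod>i<j. s - int r * int i)"
  have P0: "P \<noteq> 0" using False by (simp add: P_def)
  show ?thesis unfolding P_def[symmetric]
  proof (rule multiplicity_le_imp_dvd)
    fix q :: int assume q: "prime q"
    define p where "p = nat q"
    have pq: "q = int p" using q prime_ge_0_int by (simp add: p_def)
    have p: "prime p" using q pq by simp
    define e where "e = multiplicity q (fact j :: int)"
    have e_le: "e \<le> j"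
    proof -
      have "int (p ^ e) dvd int (fact j)"
        using multiplicity_dvd[of q "fact j :: int"] by (simp add: e_def pq)
      then have "p ^ e dvd fact j" by (simp only: int_dvd_int_iff)
      then have "e \<le> multiplicity p (fact j :: nat)"
        using p by (intro multiplicity_geI) (auto simp: prime_gt_1_nat)
      then show ?thesis using multiplicity_fact_le[OF p, of j] by simp
    qed
    have "q ^ e dvd int r ^ j * P"
    proof (cases "p dvd r")
      case True
      then have "q ^ j dvd int r ^ j" by (intro dvd_power_same) (simp add: pq)
      moreover have "q ^ e dvd q ^ j" using e_le by (rule le_imp_power_dvd)
      ultimately show ?thesis by (meson dvd_mult2 dvd_trans)
    next
      case False
      then have "coprime (q ^ e) (int r)"
        using p by (simp add: pq prime_imp_coprime)
      then obtain u v where "u * q ^ e + v * int r = 1" by (metis bezout_int coprime_iff_gcd_eq_1)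
      then have uv: "s * (u * q ^ e + v * int r) = s" by simp
      define t where "t = (v * s) mod q ^ e"
      have q0: "q > 0" using q by (rule prime_gt_0_int)
      have t0: "t \<ge> 0" using q0 by (simp add: t_def)
      have cong: "(s - int r * int i) mod q ^ e = (int r * (t - int i)) mod q ^ e" for i
      proof -
        have "(int r * (t - int i)) mod q ^ e = (int r * (v * s - int i)) mod q ^ e"
          unfolding t_def by (metis mod_diff_left_eq mod_mult_right_eq)
        also have "int r * (v * s - int i) = (s - int r * int i) + q ^ e * (- (s * u))"
          by (subst (2) uv[symmetric]) (simp add: algebra_simps)
        finally show ?thesis by (metis mod_mult_self2)
      qed
      have "P mod q ^ e = (\<Prod>i<j. (s - int r * int i) mod q ^ e) mod q ^ e"
        unfolding P_def by (rule mod_prod_eq[symmetric])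
      also have "\<dots> = (\<Prod>i<j. (int r * (t - int i)) mod q ^ e) mod q ^ e" by (simp only: cong)
      also have "\<dots> = (\<Prod>i<j. int r * (t - int i)) mod q ^ e" by (rule mod_prod_eq)
      also have "(\<Prod>i<j. int r * (t - int i)) = int r ^ j * (\<Prod>i<j. t - int i)"
        by (simp add: prod.distrib)
      finally have *: "P mod q ^ e = int r ^ j * (\<Prod>i<j. t - int i) mod q ^ e" .
      have "q ^ e dvd fact j" unfolding e_def by (rule multiplicity_dvd)
      also have "(fact j :: int) dvd (\<Prod>i<j. t - int i)"
      proof -
        have "(\<Prod>i<j. t - int i) = fact j * int (nat t choose j)"
        proof -
          have "real_of_int (\<Prod>i<j. t - int i) = (\<Prod>i = 0..<j. real (nat t) - real i)"
            using t0 by (simp add: atLeast0LessThan)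
          also have "\<dots> = fact j * (real (nat t) gchoose j)" by (rule gbinomial_mult_fact[symmetric])
          also have "\<dots> = real_of_int (fact j * int (nat t choose j))"
            by (simp add: binomial_gbinomial)
          finally show ?thesis by linarith
        qed
        then show ?thesis by simp
      qed
      finally have "q ^ e dvd int r ^ j * (\<Prod>i<j. t - int i)" by (rule dvd_mult)
      then have "q ^ e dvd P" using * by (simp add: dvd_eq_mod_eq_0)
      then show ?thesis by (rule dvd_mult)
    qed
    then show "multiplicity q (fact j) \<le> multiplicity q (int r ^ j * P)"
      unfolding e_def[symmetric] using P0 r q by (intro multiplicity_geI) auto
  qed auto
qed (simp only: mult_zero_right dvd_0_right)

lemma rational_gbinomial_denominator:
  fixes r j n :: nat and s :: int
  assumes r: "r > 0" and jn: "j \<le> n"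
  shows "real r ^ (2 * n) * ((real_of_int s / real r) gchoose j) \<in> \<int>"
proof -
  obtain k where k: "int r ^ j * (\<Prod>i<j. s - int r * int i) = fact j * k"
    using fact_dvd_falling_progression[OF r, of j s] by (auto elim: dvdE)
  have "real r ^ (2 * j) * ((real_of_int s / real r) gchoose j)
      = real r ^ (2 * j) * ((\<Prod>i<j. real_of_int s / real r - real i) / fact j)"
    by (simp add: gbinomial_prod_rev atLeast0LessThan)
  also have "(\<Prod>i<j. real_of_int s / real r - real i)
      = (\<Prod>i<j. (real_of_int s - real r * real i) / real r)"
    using r by (intro prod.cong) (auto simp: field_simps)
  also have "\<dots> = (\<Prod>i<j. real_of_int s - real r * real i) / real r ^ j"
    by (simp add: prod_dividef)
  also have "real r ^ (2 * j) * ((\<Prod>i<j. real_of_int s - real r * real i) / real r ^ j / fact j)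
      = real r ^ j * (\<Prod>i<j. real_of_int s - real r * real i) / fact j"
    using r by (simp add: mult_2 power_add)
  also have "real r ^ j * (\<Prod>i<j. real_of_int s - real r * real i)
      = real_of_int (int r ^ j * (\<Prod>i<j. s - int r * int i))" by simp
  also have "\<dots> = fact j * real_of_int k" unfolding k by simp
  finally have *: "real r ^ (2 * j) * ((real_of_int s / real r) gchoose j) = real_of_int k" by simp
  have "real r ^ (2 * n) = real r ^ (2 * n - 2 * j) * real r ^ (2 * j)"
    using jn by (simp add: power_add[symmetric])
  then have "real r ^ (2 * n) * ((real_of_int s / real r) gchoose j)
      = real r ^ (2 * n - 2 * j) * real_of_int k" using * by simp
  then show ?thesis by simp
qed

section \<open>Pade approximants of \<open>(1 - z) powr v\<close>\<close>

lemma gbinomial_pos: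
  fixes x :: real
  assumes "x > real k - 1"
  shows "x gchoose k > 0"
  unfolding gbinomial_prod_rev using assms by (intro divide_pos_pos prod_pos) auto

lemma gbinomial_le_binomial:
  fixes x :: real
  assumes "real k - 1 \<le> x" "x \<le> real n"
  shows "x gchoose k \<le> real (n choose k)"
proof -
  have "(\<Prod>i = 0..<k. x - real i) \<le> (\<Prod>i = 0..<k. real n - real i)"
    using assms by (intro prod_mono) auto
  then show ?thesis
    unfolding binomial_gbinomial gbinomial_prod_rev by (intro divide_right_mono) auto
qed

lemma abs_gbinomial_le_1:
  fixes x :: real
  assumes "0 \<le> x" "x \<le> 1"
  shows "\<bar>x gchoose k\<bar> \<le> 1"
proof (induction k)
  case (Suc k)
  have "x gchoose Suc k = (x gchoose k) * ((x - real k) / real (Suc k))"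
    using gbinomial_mult_1[of x k] by (simp add: field_simps)
  moreover have "\<bar>(x - real k) / real (Suc k)\<bar> \<le> 1"
    using assms by (simp add: abs_le_iff divide_le_eq)
  ultimately show ?case using Suc by (metis abs_ge_zero abs_mult mult_le_one)
qed simp

text \<open>
  The \<open>m\<close>-th finite difference of \<open>j \<mapsto> (q + p - j) choose q\<close>, by Pascal's rule. It expands the last
  factor of the Pade denominator in terms of \<open>m choose j\<close>, which makes Vandermonde's identity applicable.
\<close>

lemma alternating_binomial_sum:
  assumes "m \<le> q + p"
  shows "(\<Sum>j\<le>m. (-1) ^ j * real (m choose j) * real ((q + p - j) choose q)) = real ((q + p - m) choose p)"
  using assms
proof (induction m arbitrary: p)
  case 0
  show ?case using binomial_symmetric[of q "q + p"] by simp
next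
  case (Suc m)
  let ?f = "\<lambda>p m j. (-1) ^ j * real (m choose j) * real ((q + p - j) choose q)"
  show ?case
  proof (cases p)
    case 0
    have "(\<Sum>j\<le>Suc m. ?f p (Suc m) j) = ?f p (Suc m) 0 + (\<Sum>j\<le>m. ?f p (Suc m) (Suc j))"
      by (rule sum.atMost_Suc_shift)
    also have "(\<Sum>j\<le>m. ?f p (Suc m) (Suc j)) = 0"
      using 0 Suc.prems by (intro sum.neutral) auto
    finally show ?thesis using 0 by simp
  next
    case (Suc p')
    have "(\<Sum>j\<le>Suc m. ?f p (Suc m) j) = ?f p (Suc m) 0 + (\<Sum>j\<le>m. ?f p (Suc m) (Suc j))"
      by (rule sum.atMost_Suc_shift)
    also have "(\<Sum>j\<le>m. ?f p (Suc m) (Suc j)) = (\<Sum>j\<le>m. ?f p m (Suc j)) - (\<Sum>j\<le>m. ?f p' m j)"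
      unfolding sum_subtractf[symmetric]
      using Suc by (intro sum.cong refl) (simp add: algebra_simps)
    also have "?f p (Suc m) 0 + ((\<Sum>j\<le>m. ?f p m (Suc j)) - (\<Sum>j\<le>m. ?f p' m j))
        = (\<Sum>j\<le>Suc m. ?f p m j) - (\<Sum>j\<le>m. ?f p' m j)"
      unfolding sum.atMost_Suc_shift by simp
    also have "(\<Sum>j\<le>Suc m. ?f p m j) = (\<Sum>j\<le>m. ?f p m j)" by simp
    also have "\<dots> = real ((q + p - m) choose p)" using Suc.prems by (intro Suc.IH) simp
    also have "(\<Sum>j\<le>m. ?f p' m j) = real ((q + p' - m) choose p')"
      using Suc.prems Suc by (intro Suc.IH) simp
    also have "real ((q + p - m) choose p) - real ((q + p' - m) choose p') = real ((q + p - Suc m) choose p)"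
    proof -
      have "q + p - m = Suc (q + p' - m)" "q + p - Suc m = q + p' - m" using Suc Suc.prems by auto
      then show ?thesis using Suc by simp
    qed
    finally show ?thesis .
  qed
qed

text \<open>
  The power series of \<open>(1 - z) powr v\<close>.
\<close>

definition root_series :: "real \<Rightarrow> real fps" where
  "root_series v = Abs_fps (\<lambda>k. (-1) ^ k * (v gchoose k))"

text \<open>
  The coefficients of the denominator of the diagonal Pade approximant of \<open>(1 - z) powr v\<close>, up to
  scaling the hypergeometric polynomial \<open>F(-n, -n+v; -2n; z)\<close>.
\<close>

definition pade_den_coeff :: "real \<Rightarrow> nat \<Rightarrow> nat \<Rightarrow> real" where
  "pade_den_coeff v n m =
     (if m \<le> n then (-1) ^ m * ((real n - v) gchoose m) * real ((2 * n - m) choose n) else 0)"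

definition pade_den :: "real \<Rightarrow> nat \<Rightarrow> real poly" where
  "pade_den v n = (\<Sum>m\<le>n. monom (pade_den_coeff v n m) m)"

text \<open>
  The product of the denominator and the power series, truncated after degree \<open>n\<close>. That the
  coefficients of degree \<open>n + 1\<close> to \<open>2 n\<close> of this product are zero makes the quotient a Pade approximant.
\<close>

definition pade_num :: "real \<Rightarrow> nat \<Rightarrow> real poly" where
  "pade_num v n = (\<Sum>k\<le>n. monom (fps_nth (fps_of_poly (pade_den v n) * root_series v) k) k)"

lemma coeff_sum_monom: "coeff (\<Sum>m\<le>n. monom (f m) m) k = (if k \<le> n then f k else 0)"
  by (simp add: coeff_sum)

lemma coeff_pade_den: "coeff (pade_den v n) m = pade_den_coeff v n m"
  by (simp add: pade_den_def coeff_sum_monom pade_den_coeff_def)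

lemma degree_pade_den: "degree (pade_den v n) \<le> n"
  by (rule degree_le) (simp add: coeff_pade_den pade_den_coeff_def)

lemma degree_pade_num: "degree (pade_num v n) \<le> n"
  by (rule degree_le) (simp add: pade_num_def coeff_sum_monom)

text \<open>
  This rewriting of the Cauchy product serves three purposes: for \<open>n < k \<le> 2 n\<close> all summands are zero,
  for \<open>k \<le> n\<close> the sum has the same denominators as the coefficients \<open>(n - v) gchoose j\<close> with \<open>j \<le> n\<close>, and
  for \<open>k = n\<close> it has a closed form. It results from expanding \<open>(2 n - m) choose n\<close> by
  \<open>alternating_binomial_sum\<close>, exchanging the sums, and applying Vandermonde's identity to the inner one.
\<close>

lemma pade_den_times_root_series_nth:
  assumes k: "k \<le> 2 * n"
  shows "fps_nth (fps_of_poly (pade_den v n) * root_series v) k =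
    (-1) ^ k * (\<Sum>j\<le>k. (-1) ^ j * real ((2 * n - j) choose n) * ((real n - v) gchoose j)
                  * ((real n - real j) gchoose (k - j)))"
proof -
  let ?w = "real n - v"
  have "fps_nth (fps_of_poly (pade_den v n) * root_series v) k
      = (\<Sum>m\<le>k. pade_den_coeff v n m * ((-1) ^ (k - m) * (v gchoose (k - m))))"
    by (simp add: fps_mult_nth coeff_pade_den root_series_def atLeast0AtMost)
  also have "\<dots> = (\<Sum>m\<le>k. (-1) ^ k * ((?w gchoose m) * (v gchoose (k - m)) * real ((2 * n - m) choose n)))"
  proof (intro sum.cong refl)
    fix m assume "m \<in> {..k}"
    then have m: "m \<le> k" by simp
    have "(-1::real) ^ k = (-1) ^ m * (-1) ^ (k - m)" using m by (simp flip: power_add)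
    moreover have "\<not> m \<le> n \<Longrightarrow> (2 * n - m) choose n = 0" using m k by simp
    ultimately show "pade_den_coeff v n m * ((-1) ^ (k - m) * (v gchoose (k - m)))
        = (-1) ^ k * ((?w gchoose m) * (v gchoose (k - m)) * real ((2 * n - m) choose n))"
      by (simp add: pade_den_coeff_def)
  qed
  also have "\<dots> = (-1) ^ k * (\<Sum>m\<le>k. \<Sum>j\<le>k. (?w gchoose m) * (v gchoose (k - m))
                 * ((-1) ^ j * real (m choose j) * real ((2 * n - j) choose n)))"
    unfolding sum_distrib_left[symmetric]
  proof (intro arg_cong[where f = "\<lambda>x. (-1) ^ k * x"] sum.cong refl)
    fix m assume "m \<in> {..k}"
    then have m: "m \<le> k" by simp
    have "real ((2 * n - m) choose n) = (\<Sum>j\<le>m. (-1) ^ j * real (m choose j) * real ((2 * n - j) choose n))"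
      using alternating_binomial_sum[of m n n] m k by (simp add: mult_2)
    also have "\<dots> = (\<Sum>j\<le>k. (-1) ^ j * real (m choose j) * real ((2 * n - j) choose n))"
      using m by (intro sum.mono_neutral_left) auto
    finally show "(?w gchoose m) * (v gchoose (k - m)) * real ((2 * n - m) choose n)
       = (?w gchoose m) * (v gchoose (k - m)) * (\<Sum>j\<le>k. (-1) ^ j * real (m choose j) * real ((2 * n - j) choose n))"
      by simp
  qed
  \<comment> \<open>The inner sum runs up to \<open>k\<close> instead of \<open>m\<close>, which adds only zeros and lets the sums be exchanged.\<close>
  also have "(\<Sum>m\<le>k. \<Sum>j\<le>k. (?w gchoose m) * (v gchoose (k - m))
                 * ((-1) ^ j * real (m choose j) * real ((2 * n - j) choose n)))
     = (\<Sum>j\<le>k. (-1) ^ j * real ((2 * n - j) choose n) *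
           (\<Sum>m\<le>k. (?w gchoose m) * real (m choose j) * (v gchoose (k - m))))"
    by (subst sum.swap) (simp add: sum_distrib_left mult_ac)
  also have "\<dots> = (\<Sum>j\<le>k. (-1) ^ j * real ((2 * n - j) choose n) *
           ((?w gchoose j) * ((real n - real j) gchoose (k - j))))"
  proof (intro sum.cong refl arg_cong2[where f = "(*)"])
    fix j assume "j \<in> {..k}"
    then have j: "j \<le> k" by simp
    have "(\<Sum>m\<le>k. (?w gchoose m) * real (m choose j) * (v gchoose (k - m)))
        = (\<Sum>m\<in>(+) j ` {0..k - j}. (?w gchoose m) * real (m choose j) * (v gchoose (k - m)))"
    proof (rule sum.mono_neutral_right)
      show "\<forall>m\<in>{..k} - (+) j ` {0..k - j}. (?w gchoose m) * real (m choose j) * (v gchoose (k - m)) = 0"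
      proof
        fix m assume m: "m \<in> {..k} - (+) j ` {0..k - j}"
        have "m < j"
        proof (rule ccontr)
          assume "\<not> m < j"
          then have "m = j + (m - j)" "m - j \<in> {0..k - j}" using m by auto
          then show False using m by blast
        qed
        then show "(?w gchoose m) * real (m choose j) * (v gchoose (k - m)) = 0" by simp
      qed
    qed (use j in auto)
    also have "\<dots> = (\<Sum>i\<in>{0..k - j}. (?w gchoose (j + i)) * real ((j + i) choose j) * (v gchoose (k - j - i)))"
      by (subst sum.reindex) auto
    also have "\<dots> = (\<Sum>i\<in>{0..k - j}. (?w gchoose j) * (((?w - real j) gchoose i) * (v gchoose (k - j - i))))"
    proof (intro sum.cong refl)
      fix i
      have "(?w gchoose (j + i)) * real ((j + i) choose j) = (?w gchoose j) * ((?w - real j) gchoose i)"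
        using gbinomial_trinomial_revision[of j "j + i" ?w] by (simp add: binomial_gbinomial)
      then show "(?w gchoose (j + i)) * real ((j + i) choose j) * (v gchoose (k - j - i))
        = (?w gchoose j) * (((?w - real j) gchoose i) * (v gchoose (k - j - i)))"
        by (metis mult.assoc)
    qed
    also have "\<dots> = (?w gchoose j) * ((?w - real j + v) gchoose (k - j))"
      by (simp only: sum_distrib_left[symmetric] gbinomial_Vandermonde)
    finally show "(\<Sum>m\<le>k. (?w gchoose m) * real (m choose j) * (v gchoose (k - m)))
        = (?w gchoose j) * ((real n - real j) gchoose (k - j))" by (simp add: algebra_simps)
  qed
  finally show ?thesis by (simp add: mult.assoc)
qed

lemma pade_remainder_nth_eq_0:
  assumes k: "k \<le> 2 * n"
  shows "fps_nth (fps_of_poly (pade_num v n) - fps_of_poly (pade_den v n) * root_series v) k = 0"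
proof (cases "k \<le> n")
  case True
  then show ?thesis by (simp add: pade_num_def coeff_sum_monom)
next
  case False
  have "(\<Sum>j\<le>k. (-1) ^ j * real ((2 * n - j) choose n) * ((real n - v) gchoose j)
                  * ((real n - real j) gchoose (k - j))) = 0"
  proof (intro sum.neutral ballI)
    fix j assume j: "j \<in> {..k}"
    show "(-1) ^ j * real ((2 * n - j) choose n) * ((real n - v) gchoose j)
                  * ((real n - real j) gchoose (k - j)) = 0"
    proof (cases "j \<le> n")
      case True
      then have "((real n - real j) gchoose (k - j)) = real ((n - j) choose (k - j))"
        by (simp add: binomial_gbinomial)
      also have "\<dots> = 0" using True False by simp
      finally show ?thesis by simp
    next
      case False
      then have "(2 * n - j) choose n = 0" using j k by simp
      then show ?thesis by simp
    qed
  qed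
  then have "fps_nth (fps_of_poly (pade_den v n) * root_series v) k = 0"
    by (subst pade_den_times_root_series_nth[OF k]) simp
  then show ?thesis using False by (simp add: pade_num_def coeff_sum_monom)
qed

lemma lead_pade_den: "coeff (pade_den v n) n = (-1) ^ n * ((real n - v) gchoose n)"
  by (simp add: coeff_pade_den pade_den_coeff_def)

text \<open>
  Up to sign, \<open>(2 n - j) choose n\<close> is \<open>(- n - 1) gchoose (n - j)\<close>, so this is Vandermonde's identity for the
  upper arguments \<open>n - v\<close> and \<open>- n - 1\<close>.
\<close>

lemma lead_pade_num: "coeff (pade_num v n) n = (-1) ^ n * ((v + real n) gchoose n)"
proof -
  have "coeff (pade_num v n) n = (-1) ^ n * (\<Sum>j\<le>n. (-1) ^ j * real ((2 * n - j) choose n) * ((real n - v) gchoose j))"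
  proof -
    have "(real n - real j) gchoose (n - j) = 1" if "j \<le> n" for j
      using that binomial_gbinomial[of "n - j" "n - j", where 'a = real] by simp
    then show ?thesis
      by (simp add: pade_num_def coeff_sum_monom pade_den_times_root_series_nth)
  qed
  also have "\<dots> = (\<Sum>j\<in>{0..n}. ((real n - v) gchoose j) * ((- (real n + 1)) gchoose (n - j)))"
    unfolding sum_distrib_left
  proof (intro sum.cong)
    fix j assume "j \<in> {0..n}"
    then have j: "j \<le> n" by simp
    have "(- (real n + 1)) gchoose (n - j) = (-1) ^ (n - j) * ((real n + 1 + real (n - j) - 1) gchoose (n - j))"
      by (rule gbinomial_minus)
    also have "real n + 1 + real (n - j) - 1 = real (2 * n - j)" using j by simp
    also have "real (2 * n - j) gchoose (n - j) = real ((2 * n - j) choose (n - j))"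
      by (simp add: binomial_gbinomial)
    also have "(2 * n - j) choose (n - j) = (2 * n - j) choose n"
      using binomial_symmetric[of n "2 * n - j"] j by simp
    also have "(-1::real) ^ (n - j) = (-1) ^ n * (-1) ^ j"
      using j by (auto simp: minus_one_power_iff)
    finally show "(-1) ^ n * ((-1) ^ j * real ((2 * n - j) choose n) * ((real n - v) gchoose j))
        = ((real n - v) gchoose j) * ((- (real n + 1)) gchoose (n - j))" by simp
  qed auto
  also have "\<dots> = (real n - v + (- (real n + 1))) gchoose n" by (rule gbinomial_Vandermonde)
  also have "\<dots> = (- (1 + v)) gchoose n" by (simp add: algebra_simps)
  also have "\<dots> = (-1) ^ n * ((1 + v + real n - 1) gchoose n)" by (rule gbinomial_minus)
  finally show ?thesis by simp
qed

lemma coeff_mult_top: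
  fixes p q :: "'a :: comm_semiring_0 poly"
  assumes "degree p \<le> m" "degree q \<le> n"
  shows "coeff (p * q) (m + n) = coeff p m * coeff q n"
proof -
  have "coeff (p * q) (m + n) = (\<Sum>i\<in>{m}. coeff p i * coeff q (m + n - i))"
    unfolding coeff_mult
  proof (rule sum.mono_neutral_right)
    show "\<forall>i\<in>{..m + n} - {m}. coeff p i * coeff q (m + n - i) = 0"
    proof
      fix i assume "i \<in> {..m + n} - {m}"
      then consider "i > m" | "m + n - i > n" by fastforce
      then show "coeff p i * coeff q (m + n - i) = 0"
        using assms by cases (simp_all add: coeff_eq_0)
    qed
  qed auto
  then show ?thesis by simp
qed

text \<open>
  The determinant of two consecutive approximants is a polynomial of degree at most \<open>2 n + 1\<close> by the
  degrees of its entries, and it vanishes to order \<open>2 n + 1\<close> at \<open>0\<close>, because it does not change when the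
  numerators are replaced by the remainders. So it is a monomial, whose coefficient is found from the
  leading coefficients.
\<close>

lemma pade_determinant:
  assumes v: "0 < v" "v < 1" and z: "z \<noteq> 0"
  shows "poly (pade_num v (Suc n)) z * poly (pade_den v n) z
       \<noteq> poly (pade_num v n) z * poly (pade_den v (Suc n)) z"
proof -
  define D where "D = pade_num v (Suc n) * pade_den v n - pade_num v n * pade_den v (Suc n)"
  define E where "E n = fps_of_poly (pade_num v n) - fps_of_poly (pade_den v n) * root_series v" for n
  define k where "k = coeff D (Suc (2 * n))"
  have low: "coeff D i = 0" if i: "i \<le> 2 * n" for i
  proof -
    have "fps_of_poly D = fps_of_poly (pade_den v n) * E (Suc n) - fps_of_poly (pade_den v (Suc n)) * E n"
      by (simp add: D_def E_def fps_of_poly_simps algebra_simps)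
    then have "coeff D i = fps_nth (fps_of_poly (pade_den v n) * E (Suc n)) i
        - fps_nth (fps_of_poly (pade_den v (Suc n)) * E n) i"
      by (metis fps_of_poly_nth fps_sub_nth)
    also have "fps_nth (fps_of_poly (pade_den v n) * E (Suc n)) i = 0"
      unfolding fps_mult_nth using i
      by (intro sum.neutral) (auto simp: E_def simp del: fps_sub_nth intro!: pade_remainder_nth_eq_0)
    also have "fps_nth (fps_of_poly (pade_den v (Suc n)) * E n) i = 0"
      unfolding fps_mult_nth using i
      by (intro sum.neutral) (auto simp: E_def simp del: fps_sub_nth intro!: pade_remainder_nth_eq_0)
    finally show ?thesis by simp
  qed
  have deg: "degree D \<le> Suc (2 * n)"
    unfolding D_def
  proof (rule degree_diff_le)
    show "degree (pade_num v (Suc n) * pade_den v n) \<le> Suc (2 * n)"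
      using degree_mult_le[of "pade_num v (Suc n)" "pade_den v n"]
        degree_pade_num[of v "Suc n"] degree_pade_den[of v n] by linarith
    show "degree (pade_num v n * pade_den v (Suc n)) \<le> Suc (2 * n)"
      using degree_mult_le[of "pade_num v n" "pade_den v (Suc n)"]
        degree_pade_num[of v n] degree_pade_den[of v "Suc n"] by linarith
  qed
  have "D = monom k (Suc (2 * n))"
  proof (rule poly_eqI)
    fix i
    consider "i \<le> 2 * n" | "i = Suc (2 * n)" | "i > Suc (2 * n)" by linarith
    then show "coeff D i = coeff (monom k (Suc (2 * n))) i"
      using low deg by cases (auto simp: k_def coeff_eq_0)
  qed
  then have "poly D z = k * z ^ Suc (2 * n)" by (simp add: poly_monom)
  moreover have "k \<noteq> 0"
  proof -
    let ?N = "(v + real n) gchoose n" and ?M = "(real n - v) gchoose n"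
    have "k = coeff (pade_num v (Suc n)) (Suc n) * coeff (pade_den v n) n
        - coeff (pade_num v n) n * coeff (pade_den v (Suc n)) (Suc n)"
      using coeff_mult_top[OF degree_pade_num degree_pade_den, of v "Suc n" v n]
        coeff_mult_top[OF degree_pade_num degree_pade_den, of v n v "Suc n"]
      by (simp add: k_def D_def mult_2)
    also have "\<dots> = - ((v + real (Suc n)) gchoose (Suc n)) * ?M
        + ?N * ((real (Suc n) - v) gchoose (Suc n))"
      unfolding lead_pade_num lead_pade_den by (simp add: minus_one_power_iff)
    also have "(v + real (Suc n)) gchoose (Suc n) = (v + real n + 1) / real (Suc n) * ?N"
      using gbinomial_factors[of "v + real n" n] by (simp add: add_ac)
    also have "(real (Suc n) - v) gchoose (Suc n) = (real n - v + 1) / real (Suc n) * ?M"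
      using gbinomial_factors[of "real n - v" n] by (simp add: add_ac algebra_simps)
    also have "- ((v + real n + 1) / real (Suc n) * ?N) * ?M + ?N * ((real n - v + 1) / real (Suc n) * ?M)
        = - (2 * v / real (Suc n)) * ?N * ?M"
    proof -
      have "- (A / s * N) * M + N * (B / s * M) = ((B - A) / s) * N * M" for A B s N M :: real
        by (simp add: diff_divide_distrib algebra_simps)
      then show ?thesis by simp
    qed
    finally have "k = - (2 * v / real (Suc n)) * ?N * ?M" .
    moreover have "?N > 0" "?M > 0" using v by (auto intro!: gbinomial_pos)
    ultimately show ?thesis using v by simp
  qed
  ultimately have "poly D z \<noteq> 0" using z by simp
  then show ?thesis by (simp add: D_def)
qed

text \<open>
  The factor \<open>2 ^ n\<close> comes from summing \<open>n choose m\<close>, the factor \<open>4 ^ n\<close> from \<open>(2 n - m) choose n\<close>.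
\<close>

lemma sum_abs_pade_den_coeff_le:
  assumes v: "0 \<le> v" "v \<le> 1"
  shows "(\<Sum>m\<le>n. \<bar>pade_den_coeff v n m\<bar>) \<le> 8 ^ n"
proof -
  have "\<bar>pade_den_coeff v n m\<bar> \<le> real (n choose m) * 4 ^ n" if m: "m \<le> n" for m
  proof -
    have "0 \<le> (real n - v) gchoose m"
    proof -
      have "0 \<le> (\<Prod>i = 0..<m. real n - v - real i)" using v m by (intro prod_nonneg) auto
      then show ?thesis unfolding gbinomial_prod_rev by simp
    qed
    moreover have "(real n - v) gchoose m \<le> real (n choose m)"
      using v m by (intro gbinomial_le_binomial) auto
    moreover have "real ((2 * n - m) choose n) \<le> 4 ^ n"
    proof -
      have "(2 * n - m) choose n \<le> 2 ^ (2 * n - m)" by (rule binomial_le_pow2)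
      also have "\<dots> \<le> 2 ^ (2 * n)" by (rule power_increasing) auto
      also have "\<dots> = (4::nat) ^ n" by (simp add: power_mult)
      finally show ?thesis by (metis of_nat_le_iff of_nat_numeral of_nat_power)
    qed
    ultimately show ?thesis using m by (simp add: pade_den_coeff_def abs_mult mult_mono)
  qed
  then have "(\<Sum>m\<le>n. \<bar>pade_den_coeff v n m\<bar>) \<le> (\<Sum>m\<le>n. real (n choose m) * 4 ^ n)"
    by (intro sum_mono) auto
  also have "\<dots> = real (\<Sum>m\<le>n. n choose m) * 4 ^ n"
    by (simp add: sum_distrib_right)
  also have "\<dots> = 8 ^ n" by (simp add: choose_row_sum power_mult_distrib[symmetric])
  finally show ?thesis .
qed

lemma abs_poly_pade_den_le:
  assumes v: "0 \<le> v" "v \<le> 1" and z: "0 \<le> z" "z \<le> 1"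
  shows "\<bar>poly (pade_den v n) z\<bar> \<le> 8 ^ n"
proof -
  have "\<bar>poly (pade_den v n) z\<bar> \<le> (\<Sum>m\<le>n. \<bar>pade_den_coeff v n m * z ^ m\<bar>)"
    unfolding pade_den_def poly_sum poly_monom by (rule sum_abs)
  also have "\<dots> \<le> (\<Sum>m\<le>n. \<bar>pade_den_coeff v n m\<bar>)"
    using z by (intro sum_mono) (auto simp: abs_mult power_le_one mult_left_le)
  also have "\<dots> \<le> 8 ^ n" by (rule sum_abs_pade_den_coeff_le[OF v])
  finally show ?thesis .
qed

text \<open>
  The remainder is a power series that starts at \<open>z ^ (2 n + 1)\<close>. As the coefficients of the series of
  \<open>(1 - z) powr v\<close> are at most \<open>1\<close> in absolute value, all its coefficients are at most \<open>8 ^ n\<close>, and a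
  geometric series with ratio at most \<open>1/2\<close> remains.
\<close>

lemma pade_remainder_bound:
  assumes v: "0 \<le> v" "v \<le> 1" and z: "0 \<le> z" "z \<le> 1 / 2"
  shows "\<bar>poly (pade_num v n) z - (1 - z) powr v * poly (pade_den v n) z\<bar> \<le> 2 * 8 ^ n * z ^ (2 * n + 1)"
proof -
  let ?f = "\<lambda>k. fps_nth (root_series v) k"
  define E where "E = fps_of_poly (pade_num v n) - fps_of_poly (pade_den v n) * root_series v"
  have f: "(\<lambda>k. ?f k * z ^ k) sums ((1 - z) powr v)"
    using gen_binomial_real[of "- z" v] z
    by (simp add: root_series_def power_minus[of z] mult_ac)
  have "(\<lambda>k. if k < m then 0 else pade_den_coeff v n m * ?f (k - m) * z ^ k)
      sums (pade_den_coeff v n m * z ^ m * (1 - z) powr v)" for m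
  proof -
    have "(\<lambda>k. pade_den_coeff v n m * z ^ m * (?f k * z ^ k))
        sums (pade_den_coeff v n m * z ^ m * (1 - z) powr v)"
      by (rule sums_mult[OF f])
    then have "(\<lambda>k. (\<lambda>k. if k < m then 0 else pade_den_coeff v n m * ?f (k - m) * z ^ k) (k + m))
        sums (pade_den_coeff v n m * z ^ m * (1 - z) powr v)"
      by (simp add: power_add mult_ac)
    then show ?thesis by (subst (asm) sums_iff_shift) simp
  qed
  then have "(\<lambda>k. \<Sum>m\<le>n. if k < m then 0 else pade_den_coeff v n m * ?f (k - m) * z ^ k)
      sums (\<Sum>m\<le>n. pade_den_coeff v n m * z ^ m * (1 - z) powr v)"
    by (intro sums_sum)
  also have "(\<Sum>m\<le>n. pade_den_coeff v n m * z ^ m * (1 - z) powr v) = (1 - z) powr v * poly (pade_den v n) z"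
    by (simp add: pade_den_def poly_sum poly_monom sum_distrib_left mult_ac)
  also have "(\<lambda>k. \<Sum>m\<le>n. if k < m then 0 else pade_den_coeff v n m * ?f (k - m) * z ^ k)
      = (\<lambda>k. fps_nth (fps_of_poly (pade_den v n) * root_series v) k * z ^ k)"
  proof
    fix k
    have "(\<Sum>m\<le>n. if k < m then 0 else pade_den_coeff v n m * ?f (k - m) * z ^ k)
        = (\<Sum>m\<in>{..n} \<inter> {..k}. pade_den_coeff v n m * ?f (k - m) * z ^ k)"
      by (intro sum.mono_neutral_cong_right) auto
    also have "\<dots> = (\<Sum>m\<le>k. pade_den_coeff v n m * ?f (k - m) * z ^ k)"
      by (intro sum.mono_neutral_left) (auto simp: pade_den_coeff_def)
    finally show "(\<Sum>m\<le>n. if k < m then 0 else pade_den_coeff v n m * ?f (k - m) * z ^ k)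
        = fps_nth (fps_of_poly (pade_den v n) * root_series v) k * z ^ k"
      by (simp add: fps_mult_nth coeff_pade_den sum_distrib_right atLeast0AtMost)
  qed
  finally have B: "(\<lambda>k. fps_nth (fps_of_poly (pade_den v n) * root_series v) k * z ^ k)
      sums ((1 - z) powr v * poly (pade_den v n) z)" .
  have A: "(\<lambda>k. coeff (pade_num v n) k * z ^ k) sums poly (pade_num v n) z"
    unfolding poly_altdef by (rule sums_finite) (auto simp: coeff_eq_0)
  have "(\<lambda>k. fps_nth E k * z ^ k) sums (poly (pade_num v n) z - (1 - z) powr v * poly (pade_den v n) z)"
    using sums_diff[OF A B] by (simp add: E_def left_diff_distrib)
  then have E: "(\<lambda>k. fps_nth E (k + (2 * n + 1)) * z ^ (k + (2 * n + 1)))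
      sums (poly (pade_num v n) z - (1 - z) powr v * poly (pade_den v n) z)"
    by (subst sums_iff_shift) (simp add: E_def pade_remainder_nth_eq_0 lessThan_Suc_atMost del: fps_sub_nth)
  have bnd: "\<bar>fps_nth E (k + (2 * n + 1)) * z ^ (k + (2 * n + 1))\<bar> \<le> 8 ^ n * z ^ (2 * n + 1) * (1 / 2) ^ k" for k
  proof -
    let ?K = "k + (2 * n + 1)"
    have "\<bar>fps_nth E ?K\<bar> = \<bar>\<Sum>m\<le>?K. pade_den_coeff v n m * ?f (?K - m)\<bar>"
      by (simp add: E_def pade_num_def coeff_sum_monom fps_mult_nth coeff_pade_den atLeast0AtMost)
    also have "\<dots> \<le> (\<Sum>m\<le>?K. \<bar>pade_den_coeff v n m\<bar>)"
    proof (rule order_trans[OF sum_abs sum_mono])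
      fix m
      have "\<bar>?f (?K - m)\<bar> \<le> 1" using abs_gbinomial_le_1[OF v] by (simp add: root_series_def abs_mult)
      then show "\<bar>pade_den_coeff v n m * ?f (?K - m)\<bar> \<le> \<bar>pade_den_coeff v n m\<bar>"
        by (simp add: abs_mult mult_left_le)
    qed
    also have "\<dots> = (\<Sum>m\<le>n. \<bar>pade_den_coeff v n m\<bar>)"
      by (intro sum.mono_neutral_right) (auto simp: pade_den_coeff_def)
    also have "\<dots> \<le> 8 ^ n" by (rule sum_abs_pade_den_coeff_le[OF v])
    finally have "\<bar>fps_nth E ?K\<bar> \<le> 8 ^ n" .
    moreover have "z ^ ?K \<le> z ^ (2 * n + 1) * (1 / 2) ^ k"
    proof -
      have "z ^ k \<le> (1 / 2) ^ k" using z by (intro power_mono) auto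
      then show ?thesis using z by (subst power_add) (simp add: mult.commute mult_right_mono)
    qed
    ultimately have "\<bar>fps_nth E ?K\<bar> * z ^ ?K \<le> 8 ^ n * (z ^ (2 * n + 1) * (1 / 2) ^ k)"
      using z by (intro mult_mono) auto
    then show ?thesis using z by (simp add: abs_mult mult.assoc)
  qed
  have g: "(\<lambda>k. 8 ^ n * z ^ (2 * n + 1) * (1 / 2) ^ k) sums (8 ^ n * z ^ (2 * n + 1) * 2)"
    using sums_mult[OF geometric_sums[of "1 / 2 :: real"], of "8 ^ n * z ^ (2 * n + 1)"] by simp
  have "\<bar>\<Sum>k. fps_nth E (k + (2 * n + 1)) * z ^ (k + (2 * n + 1))\<bar>
      \<le> (\<Sum>k. 8 ^ n * z ^ (2 * n + 1) * (1 / 2) ^ k)"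
    using suminf_le[of "\<lambda>k. fps_nth E (k + (2 * n + 1)) * z ^ (k + (2 * n + 1))"
        "\<lambda>k. 8 ^ n * z ^ (2 * n + 1) * (1 / 2) ^ k"]
      suminf_le[of "\<lambda>k. - (fps_nth E (k + (2 * n + 1)) * z ^ (k + (2 * n + 1)))"
        "\<lambda>k. 8 ^ n * z ^ (2 * n + 1) * (1 / 2) ^ k"]
      bnd sums_summable[OF E] sums_summable[OF g]
    by (simp only: abs_le_iff summable_minus suminf_minus)
  then show ?thesis using sums_unique[OF E] sums_unique[OF g] by (simp add: mult_ac)
qed

text \<open>
  After homogenisation, every term except the one with \<open>k = 0\<close> contains the factor \<open>c\<close>, and the terms with
  \<open>k = 0\<close> agree.
\<close>

lemma homogenised_values_congruent:
  fixes w c :: int and p q :: "real poly" and F :: real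
  assumes w: "w \<noteq> 0" and deg: "degree p \<le> n" "degree q \<le> n"
    and p: "\<And>k. k \<le> n \<Longrightarrow> F * coeff p k \<in> \<int>" and q: "\<And>k. k \<le> n \<Longrightarrow> F * coeff q k \<in> \<int>"
    and pq: "coeff p 0 = coeff q 0"
  shows "\<exists>P Q :: int. of_int P = F * of_int w ^ n * poly p (of_int c / of_int w) \<and>
     of_int Q = F * of_int w ^ n * poly q (of_int c / of_int w) \<and> c dvd P - Q"
proof -
  define f' g' where "f' k = \<lfloor>F * coeff p k\<rfloor>" and "g' k = \<lfloor>F * coeff q k\<rfloor>" for k
  have f': "of_int (f' k) = F * coeff p k" and g': "of_int (g' k) = F * coeff q k" if "k \<le> n" for k
    using p[OF that] q[OF that] by (auto simp: f'_def g'_def)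
  have homog: "F * of_int w ^ n * poly (\<Sum>k\<le>n. monom (h k) k) (of_int c / of_int w)
      = of_int (\<Sum>k\<le>n. h' k * c ^ k * w ^ (n - k))"
    if "\<And>k. k \<le> n \<Longrightarrow> of_int (h' k) = F * h k" for h :: "nat \<Rightarrow> real" and h' :: "nat \<Rightarrow> int"
    unfolding poly_sum poly_monom sum_distrib_left of_int_sum
  proof (intro sum.cong refl)
    fix k assume "k \<in> {..n}"
    then have k: "k \<le> n" by simp
    have "(of_int w :: real) ^ n = of_int w ^ (n - k) * of_int w ^ k"
      using k by (simp flip: power_add)
    then show "F * of_int w ^ n * (h k * (of_int c / of_int w) ^ k)
        = of_int (h' k * c ^ k * w ^ (n - k))"
      using w that[OF k] by (simp add: power_divide)
  qed
  have "f' 0 = g' 0" by (simp add: f'_def g'_def pq)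
  then have "c dvd f' k * c ^ k * w ^ (n - k) - g' k * c ^ k * w ^ (n - k)" for k
    by (cases k) (auto simp: algebra_simps)
  then have "c dvd (\<Sum>k\<le>n. f' k * c ^ k * w ^ (n - k)) - (\<Sum>k\<le>n. g' k * c ^ k * w ^ (n - k))"
    unfolding sum_subtractf[symmetric] by (intro dvd_sum) auto
  moreover have "F * of_int w ^ n * poly p (of_int c / of_int w)
      = of_int (\<Sum>k\<le>n. f' k * c ^ k * w ^ (n - k))"
    by (subst poly_as_sum_of_monoms'[OF deg(1), symmetric], rule homog, erule f')
  moreover have "F * of_int w ^ n * poly q (of_int c / of_int w)
      = of_int (\<Sum>k\<le>n. g' k * c ^ k * w ^ (n - k))"
    by (subst poly_as_sum_of_monoms'[OF deg(2), symmetric], rule homog, erule g')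
  ultimately show ?thesis by (metis (no_types))
qed

lemma pade_homogenised:
  fixes r n :: nat and w c :: int
  assumes r: "r > 0" and w: "w \<noteq> 0"
  shows "\<exists>P Q :: int.
     of_int P = real r ^ (2 * n) * of_int w ^ n * poly (pade_num (1 / real r) n) (of_int c / of_int w) \<and>
     of_int Q = real r ^ (2 * n) * of_int w ^ n * poly (pade_den (1 / real r) n) (of_int c / of_int w) \<and>
     c dvd P - Q"
proof -
  let ?v = "1 / real r"
  have int: "real r ^ (2 * n) * ((real n - ?v) gchoose j) \<in> \<int>" if "j \<le> n" for j
  proof -
    have "real n - ?v = real_of_int (int r * int n - 1) / real r" using r by (simp add: field_simps)
    then show ?thesis using rational_gbinomial_denominator[OF r that] by metis
  qed
  have den: "real r ^ (2 * n) * pade_den_coeff ?v n j \<in> \<int>" if j: "j \<le> n" for j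
  proof -
    have "real r ^ (2 * n) * pade_den_coeff ?v n j
        = (-1) ^ j * real ((2 * n - j) choose n) * (real r ^ (2 * n) * ((real n - ?v) gchoose j))"
      using j by (simp add: pade_den_coeff_def)
    also have "\<dots> \<in> \<int>" by (rule Ints_mult[OF _ int[OF j]]) simp
    finally show ?thesis .
  qed
  have num: "real r ^ (2 * n) * fps_nth (fps_of_poly (pade_den ?v n) * root_series ?v) k \<in> \<int>"
    if k: "k \<le> n" for k
  proof -
    have "real r ^ (2 * n) * fps_nth (fps_of_poly (pade_den ?v n) * root_series ?v) k
      = (-1) ^ k * (\<Sum>j\<le>k. (-1) ^ j * real ((2 * n - j) choose n)
          * (real r ^ (2 * n) * ((real n - ?v) gchoose j)) * ((real n - real j) gchoose (k - j)))"
      using k by (subst pade_den_times_root_series_nth) (simp_all add: sum_distrib_left mult_ac)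
    also have "\<dots> \<in> \<int>"
    proof (intro Ints_mult[OF _ Ints_sum])
      fix j assume "j \<in> {..k}"
      then have j: "j \<le> n" using k by simp
      have "(real n - real j) gchoose (k - j) = real ((n - j) choose (k - j))"
        using j by (simp add: binomial_gbinomial)
      then have 1: "(real n - real j) gchoose (k - j) \<in> \<int>" by simp
      show "(-1) ^ j * real ((2 * n - j) choose n)
          * (real r ^ (2 * n) * ((real n - ?v) gchoose j)) * ((real n - real j) gchoose (k - j)) \<in> \<int>"
        by (rule Ints_mult[OF Ints_mult[OF _ int[OF j]] 1]) simp
    qed simp
    finally show ?thesis .
  qed
  show ?thesis
    by (rule homogenised_values_congruent[OF w degree_pade_num degree_pade_den])
      (use num den in \<open>auto simp: pade_num_def coeff_sum_monom coeff_pade_den root_series_def\<close>)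
qed

section \<open>Gap principle and hypergeometric inequality\<close>

text \<open>
  Because \<open>X^r - Y^r \<ge> (X - Y) X^(r-1)\<close>.
\<close>

lemma root_difference_le:
  fixes X Y c :: real
  assumes "0 < Y" "Y \<le> X" "X ^ r - Y ^ r = c" "r > 0"
  shows "X - Y \<le> c / X ^ (r - 1)"
proof -
  have "Y ^ r = Y * Y ^ (r - 1)" "X ^ r = X * X ^ (r - 1)"
    using assms(4) by (simp_all add: power_eq_if)
  moreover have "Y * Y ^ (r - 1) \<le> Y * X ^ (r - 1)"
    using assms by (intro mult_left_mono power_mono) auto
  ultimately have "(X - Y) * X ^ (r - 1) \<le> c" using assms(3) by (simp add: algebra_simps)
  then show ?thesis using assms by (simp add: pos_le_divide_eq)
qed

text \<open>
  The number \<open>X1 Y2 - X2 Y1 = (X1 - Y1) Y2 - (X2 - Y2) Y1\<close> is a difference of two nonnegative terms, hence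
  at most the larger one in absolute value. Since \<open>M > 1\<close>, the second term, which is at most \<open>c\<close>, cannot
  reach \<open>M c\<close>.
\<close>

lemma gap_principle_real:
  fixes X1 Y1 X2 Y2 c M D :: real
  assumes X1: "1 \<le> Y1" "Y1 \<le> X1" "X1 ^ r - Y1 ^ r = c"
    and X2: "1 \<le> Y2" "Y2 \<le> X2" "X2 ^ r - Y2 ^ r = c"
    and "X1 \<le> X2" "r \<ge> 2" "c > 0" "M > 1"
    and D: "c \<le> \<bar>D\<bar>" "X1 * Y2 - X2 * Y1 = M * D"
  shows "M * X1 ^ (r - 1) \<le> X2"
proof -
  have d1: "X1 - Y1 \<le> c / X1 ^ (r - 1)" and d2: "X2 - Y2 \<le> c / X2 ^ (r - 1)"
    by (intro root_difference_le; use assms in linarith)+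
  have "M * D = (X1 - Y1) * Y2 - (X2 - Y2) * Y1" using D(2) by (simp add: algebra_simps)
  then have "M * \<bar>D\<bar> = \<bar>(X1 - Y1) * Y2 - (X2 - Y2) * Y1\<bar>"
    using \<open>M > 1\<close> abs_mult[of M D] by simp
  also have "\<dots> \<le> max ((X1 - Y1) * Y2) ((X2 - Y2) * Y1)"
  proof -
    have "0 \<le> (X1 - Y1) * Y2" "0 \<le> (X2 - Y2) * Y1" using X1 X2 by auto
    then show ?thesis by linarith
  qed
  also have "\<dots> \<le> max (c / X1 ^ (r - 1) * X2) c"
  proof (rule max.mono)
    show "(X1 - Y1) * Y2 \<le> c / X1 ^ (r - 1) * X2"
      using d1 X1 X2 by (intro mult_mono) auto
    have "(X2 - Y2) * Y1 \<le> c / X2 ^ (r - 1) * X2"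
      using d2 X1 X2 \<open>X1 \<le> X2\<close> by (intro mult_mono) auto
    also have "\<dots> \<le> c"
    proof -
      have "X2 ^ 1 \<le> X2 ^ (r - 1)" using X2 \<open>r \<ge> 2\<close> by (intro power_increasing) auto
      then show ?thesis using X2 \<open>c > 0\<close> by (simp add: divide_le_eq mult.commute)
    qed
    finally show "(X2 - Y2) * Y1 \<le> c" .
  qed
  finally have 1: "M * \<bar>D\<bar> \<le> max (c / X1 ^ (r - 1) * X2) c" .
  have "M * c \<le> M * \<bar>D\<bar>" using D(1) \<open>M > 1\<close> by simp
  moreover have "c < M * c" using \<open>M > 1\<close> \<open>c > 0\<close> by simp
  ultimately have "M * c \<le> c / X1 ^ (r - 1) * X2" using 1 by linarith
  then show ?thesis using X1 \<open>c > 0\<close> by (simp add: field_simps)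
qed

text \<open>
  The two terms come from splitting \<open>M N = Y2 (X1 P - Y1 Q) - Y1 Q (X2 - Y2)\<close>. In the first, the error
  \<open>X1 P - Y1 Q\<close> of the approximant is small because \<open>Y1 / X1 = (1 - z)^(1/r)\<close> for \<open>z = c / X1^r\<close>; in the
  second, \<open>X2 - Y2\<close> is small because \<open>(X2, Y2)\<close> comes from a solution. On the left, \<open>\<bar>N\<bar> \<ge> c\<close> allows dividing by \<open>c\<close>.
\<close>

lemma hypergeometric_inequality:
  fixes X1 Y1 X2 Y2 M :: real and c N P Q :: int
  assumes X1: "1 \<le> Y1" "Y1 \<le> X1" "X1 ^ r - Y1 ^ r = of_int c"
    and X2: "1 \<le> Y2" "Y2 \<le> X2" "X2 ^ r - Y2 ^ r = of_int c"
    and r: "r \<ge> 2" and c: "c > 0" and M: "M > 0" and small: "2 * of_int c \<le> X1 ^ r"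
    and P: "of_int P = real r ^ (2 * n) * (X1 ^ r) ^ n * poly (pade_num (1 / real r) n) (of_int c / X1 ^ r)"
    and Q: "of_int Q = real r ^ (2 * n) * (X1 ^ r) ^ n * poly (pade_den (1 / real r) n) (of_int c / X1 ^ r)"
    and N: "X1 * of_int P * Y2 - Y1 * of_int Q * X2 = M * of_int N" "c dvd N" "N \<noteq> 0"
  shows "M \<le> 2 * (8 * real r ^ 2) ^ n * of_int c ^ (2 * n) * X1 * X2 / X1 ^ (r * (n + 1))
            + (8 * real r ^ 2) ^ n * X1 ^ (r * n + 1) / X2 ^ (r - 1)"
proof -
  let ?C = "(8 * real r ^ 2) ^ n" and ?c = "real_of_int c" and ?v = "1 / real r"
  define z where "z = ?c / X1 ^ r"
  have C: "real r ^ (2 * n) * 8 ^ n = ?C" by (simp only: power_mult power_mult_distrib mult.commute[of "8 ^ n"])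
  have pos: "0 < X1" "0 < Y1" "0 < X2" "0 < Y2" "0 < ?c" using X1 X2 c by auto
  have z: "0 \<le> z" "z \<le> 1 / 2" using small pos by (auto simp: z_def divide_le_eq)
  have v: "0 \<le> ?v" "?v \<le> 1" using r by auto
  have root: "(1 - z) powr ?v = Y1 / X1"
  proof -
    have "Y1 ^ r = X1 ^ r - ?c" using X1(3) by simp
    then have "1 - z = (Y1 / X1) ^ r" using pos by (simp add: z_def power_divide diff_divide_distrib)
    also have "\<dots> = (Y1 / X1) powr real r" using pos by (simp add: powr_realpow)
    finally show ?thesis using pos r by (simp add: powr_powr)
  qed
  have first: "\<bar>X1 * of_int P - Y1 * of_int Q\<bar> \<le> 2 * ?C * ?c ^ (2 * n + 1) * X1 / X1 ^ (r * (n + 1))"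
  proof -
    have "X1 * of_int P - Y1 * of_int Q = X1 * (real r ^ (2 * n) * (X1 ^ r) ^ n)
        * (poly (pade_num ?v n) z - (1 - z) powr ?v * poly (pade_den ?v n) z)"
      unfolding P Q root z_def[symmetric] using pos by (simp add: field_simps)
    then have "\<bar>X1 * of_int P - Y1 * of_int Q\<bar> = X1 * (real r ^ (2 * n) * (X1 ^ r) ^ n)
        * \<bar>poly (pade_num ?v n) z - (1 - z) powr ?v * poly (pade_den ?v n) z\<bar>"
      using pos by (simp add: abs_mult)
    also have "\<dots> \<le> X1 * (real r ^ (2 * n) * (X1 ^ r) ^ n) * (2 * 8 ^ n * z ^ (2 * n + 1))"
      using pos by (intro mult_left_mono pade_remainder_bound v z) auto
    also have "\<dots> = 2 * (real r ^ (2 * n) * 8 ^ n) * X1 * ((X1 ^ r) ^ n * z ^ (2 * n + 1))"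
      by (simp only: mult_ac)
    also have "(X1 ^ r) ^ n * z ^ (2 * n + 1) = ?c ^ (2 * n + 1) / X1 ^ (r * (n + 1))"
    proof -
      have "(X1 ^ r) ^ (2 * n + 1) = (X1 ^ r) ^ n * (X1 ^ r) ^ (n + 1)" by (simp add: mult_2 power_add)
      moreover have "X1 ^ (r * (n + 1)) = (X1 ^ r) ^ (n + 1)" by (rule power_mult)
      ultimately show ?thesis using pos by (simp add: z_def power_divide)
    qed
    finally show ?thesis unfolding C by (simp add: mult_ac)
  qed
  have Qb: "\<bar>of_int Q\<bar> \<le> ?C * X1 ^ (r * n)"
  proof -
    have "\<bar>of_int Q\<bar> = real r ^ (2 * n) * (X1 ^ r) ^ n * \<bar>poly (pade_den ?v n) z\<bar>"
      unfolding Q z_def[symmetric] using pos by (simp add: abs_mult)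
    also have "\<dots> \<le> real r ^ (2 * n) * (X1 ^ r) ^ n * 8 ^ n"
      using pos z by (intro mult_left_mono abs_poly_pade_den_le v) auto
    also have "(X1 ^ r) ^ n = X1 ^ (r * n)" by (rule power_mult[symmetric])
    also have "real r ^ (2 * n) * X1 ^ (r * n) * 8 ^ n = ?C * X1 ^ (r * n)"
      unfolding C[symmetric] by (simp only: mult_ac)
    finally show ?thesis .
  qed
  have d2: "X2 - Y2 \<le> ?c / X2 ^ (r - 1)" using X2 r by (intro root_difference_le) auto
  have "M * ?c \<le> M * \<bar>of_int N\<bar>"
  proof -
    have "c \<le> \<bar>N\<bar>" using dvd_imp_le_int[OF N(3,2)] c by simp
    then have "?c \<le> \<bar>of_int N\<bar>" by linarith
    then show ?thesis using M by simp
  qed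
  also have "\<dots> = \<bar>Y2 * (X1 * of_int P - Y1 * of_int Q) - (Y1 * of_int Q) * (X2 - Y2)\<bar>"
  proof -
    have "M * of_int N = Y2 * (X1 * of_int P - Y1 * of_int Q) - (Y1 * of_int Q) * (X2 - Y2)"
      unfolding N(1)[symmetric] by (simp add: algebra_simps)
    then show ?thesis using M abs_mult[of M "of_int N"] by simp
  qed
  also have "\<dots> \<le> \<bar>Y2 * (X1 * of_int P - Y1 * of_int Q)\<bar> + \<bar>(Y1 * of_int Q) * (X2 - Y2)\<bar>"
    by (rule abs_triangle_ineq4)
  also have "\<bar>Y2 * (X1 * of_int P - Y1 * of_int Q)\<bar>
      \<le> X2 * (2 * ?C * ?c ^ (2 * n + 1) * X1 / X1 ^ (r * (n + 1)))"
    using first X2 pos by (simp only: abs_mult) (intro mult_mono, auto)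
  also have "\<bar>(Y1 * of_int Q) * (X2 - Y2)\<bar> \<le> (X1 * (?C * X1 ^ (r * n))) * (?c / X2 ^ (r - 1))"
    using Qb d2 X1 X2 pos by (simp only: abs_mult) (intro mult_mono, auto)
  finally have "M * ?c \<le> X2 * (2 * ?C * ?c ^ (2 * n + 1) * X1 / X1 ^ (r * (n + 1)))
      + (X1 * (?C * X1 ^ (r * n))) * (?c / X2 ^ (r - 1))" by simp
  also have "\<dots> = (2 * ?C * ?c ^ (2 * n) * X1 * X2 / X1 ^ (r * (n + 1))
            + ?C * X1 ^ (r * n + 1) / X2 ^ (r - 1)) * ?c"
  proof -
    have "x2 * (2 * k * (q * d) * x1 / A) + (x1 * (k * B)) * (d / E)
        = (2 * k * q * x1 * x2 / A + k * (B * x1) / E) * d" for x1 x2 k q d A B E :: real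
      by (simp add: algebra_simps)
    then show ?thesis unfolding power_add power_one_right by blast
  qed
  finally show ?thesis using pos by simp
qed

section \<open>At most two solutions in a residue class\<close>

text \<open>
  Let \<open>f n\<close> be the first term of \<open>H\<close>. It decreases geometrically, so there is a least \<open>s\<close> with \<open>f s < M/2\<close>,
  and the gap \<open>U \<ge> M W^(r-1)\<close> excludes \<open>s = 0\<close>. From \<open>f (s - 1) \<ge> M/2\<close> one gets a lower bound on \<open>U\<close>, and
  since the second term of \<open>H\<close> for \<open>s\<close> exceeds \<open>M/2\<close> one gets an upper bound. Eliminating \<open>U\<close>
  leaves \<open>W\<close> with exponent \<open>r e\<close>, where \<open>e = (r - 2) s - 2\<close>. Replacing \<open>W^r\<close> by \<open>M^r c^(r-1)\<close> cancels every
  power of \<open>c\<close>, because \<open>e \<ge> 2 (s - 1)\<close>, and leaves a power of \<open>M\<close> that is too large.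
\<close>

lemma sizes_contradict_approximation_inequalities:
  fixes W U M C c :: real and r :: nat
  assumes r: "r \<ge> 5" and c: "c \<ge> 1" and M: "M \<ge> 1" and C: "C \<ge> 1"
    and W: "W > 0" "W ^ r \<ge> M ^ r * c ^ (r - 1)" and U: "U \<ge> M * W ^ (r - 1)"
    and ratio: "C * c ^ 2 < W ^ r" and big: "M ^ (r - 3) \<ge> 4 * C ^ 2"
    and H: "\<And>n. M \<le> 2 * C ^ (n + 1) * c ^ (2 * n) * W * U / W ^ (r * (n + 1))
                 + C ^ (n + 1) * W ^ (r * (n + 1) + 1) / U ^ (r - 1)"
  shows False
proof -
  define f where "f n = 2 * C ^ (n + 1) * c ^ (2 * n) * W * U / W ^ (r * (n + 1))" for n
  have U0: "U > 0"
  proof -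
    have "0 < M * W ^ (r - 1)" using M W by simp
    then show ?thesis using U by linarith
  qed
  have f_geo: "f n = f 0 * (C * c ^ 2 / W ^ r) ^ n" for n
  proof -
    have "c ^ (2 * n) = (c ^ 2) ^ n" "W ^ (r * (n + 1)) = W ^ r * (W ^ r) ^ n"
      by (rule power_mult) (metis Suc_eq_plus1 power_Suc power_mult)
    then show ?thesis by (simp add: f_def power_divide power_mult_distrib)
  qed
  have "(\<lambda>n. f 0 * (C * c ^ 2 / W ^ r) ^ n) \<longlonglongrightarrow> f 0 * 0"
  proof (intro tendsto_mult tendsto_const LIMSEQ_power_zero)
    show "norm (C * c ^ 2 / W ^ r) < 1" using ratio C c W by simp
  qed
  then have "(\<lambda>n. f n) \<longlonglongrightarrow> 0" by (simp add: f_geo[symmetric])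
  then have "eventually (\<lambda>n. f n < M / 2) sequentially"
    using M by (intro order_tendstoD) auto
  then have ex: "\<exists>n. f n < M / 2" by (auto simp: eventually_sequentially)
  define s where "s = (LEAST n. f n < M / 2)"
  have fs: "f s < M / 2" using ex unfolding s_def by (rule LeastI_ex)
  have Wr: "W ^ r = W * W ^ (r - 1)" using r by (simp add: power_eq_if)
  have "f 0 \<ge> M / 2"
  proof -
    have "f 0 = 2 * C * U / W ^ (r - 1)" using W by (simp add: f_def Wr)
    moreover have "U / W ^ (r - 1) \<ge> M" using U W by (simp add: pos_le_divide_eq)
    moreover have "1 * M \<le> C * (U / W ^ (r - 1))" using calculation(2) C M by (intro mult_mono) auto
    ultimately show ?thesis using M by simp
  qed
  then have "s \<noteq> 0" using fs by (metis not_less)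
  then obtain t where t: "s = Suc t" by (cases s) auto
  have ft: "f t \<ge> M / 2"
    using not_less_Least[of t "\<lambda>n. f n < M / 2"] t by (simp add: s_def)
  define e where "e = (r - 2) * s - 2"
  have e1: "e + 1 \<ge> (r - 3) * s" "e \<ge> 2 * t" and e2: "(r * s - 1) * (r - 1) = r * e + (r * (s + 1) + 1)"
  proof -
    \<comment> \<open>Eliminating the truncated subtractions: all quantities are polynomials in \<open>q\<close> and \<open>t\<close>.\<close>
    obtain q where q: "r = q + 5" using r le_Suc_ex by (metis add.commute)
    have e: "e = q * t + q + 3 * t + 1" by (simp add: e_def t q algebra_simps)
    show "e + 1 \<ge> (r - 3) * s" "e \<ge> 2 * t" by (simp_all add: e q t algebra_simps)
    have "r * s - 1 = q * t + q + 5 * t + 4" by (simp add: q t algebra_simps)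
    then show "(r * s - 1) * (r - 1) = r * e + (r * (s + 1) + 1)"
      unfolding e by (simp add: q t algebra_simps)
  qed
  have i: "M * U ^ (r - 1) \<le> 2 * C ^ (s + 1) * W ^ (r * (s + 1) + 1)"
  proof -
    have "M / 2 < C ^ (s + 1) * W ^ (r * (s + 1) + 1) / U ^ (r - 1)"
      using H[of s] fs unfolding f_def by linarith
    then have "M / 2 * U ^ (r - 1) < C ^ (s + 1) * W ^ (r * (s + 1) + 1)"
      using U0 by (subst (asm) pos_less_divide_eq) auto
    then show ?thesis by simp
  qed
  have ii: "M * W ^ (r * s - 1) \<le> 4 * C ^ s * c ^ (2 * t) * U"
  proof -
    have "M / 2 \<le> 2 * C ^ s * c ^ (2 * t) * W * U / W ^ (r * s)" using ft by (simp add: f_def t)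
    then have "M / 2 * W ^ (r * s) \<le> 2 * C ^ s * c ^ (2 * t) * W * U"
      using W by (simp add: pos_le_divide_eq)
    moreover have "W ^ (r * s) = W * W ^ (r * s - 1)" using r t by (simp add: power_eq_if)
    ultimately have "W * (M * W ^ (r * s - 1)) \<le> W * (4 * C ^ s * c ^ (2 * t) * U)"
      by (simp add: algebra_simps)
    then show ?thesis using W by simp
  qed
  have "(M * W ^ (r * s - 1)) ^ (r - 1) \<le> (4 * C ^ s * c ^ (2 * t) * U) ^ (r - 1)"
    using ii M W by (intro power_mono) auto
  then have "M * (M * W ^ (r * s - 1)) ^ (r - 1) \<le> M * (4 * C ^ s * c ^ (2 * t) * U) ^ (r - 1)"
    using M by simp
  also have "\<dots> = (4 * C ^ s * c ^ (2 * t)) ^ (r - 1) * (M * U ^ (r - 1))"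
    by (simp add: power_mult_distrib mult_ac)
  also have "\<dots> \<le> (4 * C ^ s * c ^ (2 * t)) ^ (r - 1) * (2 * C ^ (s + 1) * W ^ (r * (s + 1) + 1))"
    using C c by (intro mult_left_mono i) auto
  also have "M * (M * W ^ (r * s - 1)) ^ (r - 1) = M ^ r * ((W ^ r) ^ e * W ^ (r * (s + 1) + 1))"
  proof -
    have "W ^ ((r * s - 1) * (r - 1)) = (W ^ r) ^ e * W ^ (r * (s + 1) + 1)"
      unfolding e2 by (simp add: power_add power_mult)
    moreover have "M * M ^ (r - 1) = M ^ r" using r by (simp add: power_eq_if)
    ultimately show ?thesis by (simp add: power_mult_distrib power_mult[symmetric] mult.assoc[symmetric])
  qed
  finally have "(M ^ r * (W ^ r) ^ e) * W ^ (r * (s + 1) + 1)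
      \<le> ((4 * C ^ s * c ^ (2 * t)) ^ (r - 1) * (2 * C ^ (s + 1))) * W ^ (r * (s + 1) + 1)"
    by (simp only: mult_ac)
  then have main: "M ^ r * (W ^ r) ^ e \<le> (4 * C ^ s * c ^ (2 * t)) ^ (r - 1) * (2 * C ^ (s + 1))"
    using W by (meson mult_le_cancel_right_pos zero_less_power)
  have "M ^ (r * (e + 1)) * c ^ ((r - 1) * e) = M ^ r * (M ^ r * c ^ (r - 1)) ^ e"
  proof -
    have "M ^ (r * (e + 1)) = M ^ r * (M ^ r) ^ e" by (metis Suc_eq_plus1 power_Suc power_mult)
    moreover have "c ^ ((r - 1) * e) = (c ^ (r - 1)) ^ e" by (rule power_mult)
    ultimately show ?thesis by (simp add: power_mult_distrib)
  qed
  also have "\<dots> \<le> M ^ r * (W ^ r) ^ e"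
    using M W c by (intro mult_left_mono power_mono) auto
  also note main
  also have "(4 * C ^ s * c ^ (2 * t)) ^ (r - 1) * (2 * C ^ (s + 1))
      = 2 * 4 ^ (r - 1) * C ^ (r * s + 1) * c ^ ((r - 1) * (2 * t))"
  proof -
    have "C ^ (s * (r - 1)) * C ^ (s + 1) = C ^ (r * s + 1)"
    proof -
      obtain q where "r = Suc q" using r by (cases r) auto
      then have "s * (r - 1) + (s + 1) = r * s + 1" by (simp add: algebra_simps)
      then show ?thesis by (metis power_add)
    qed
    moreover have "(C ^ s) ^ (r - 1) = C ^ (s * (r - 1))" by (rule power_mult[symmetric])
    moreover have "(c ^ (2 * t)) ^ (r - 1) = c ^ ((r - 1) * (2 * t))"
      by (subst mult.commute) (rule power_mult[symmetric])
    moreover have "(4 * C ^ s * c ^ (2 * t)) ^ (r - 1) * (2 * C ^ (s + 1))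
        = 2 * 4 ^ (r - 1) * ((C ^ s) ^ (r - 1) * C ^ (s + 1)) * (c ^ (2 * t)) ^ (r - 1)"
      by (simp only: power_mult_distrib mult_ac)
    ultimately show ?thesis by (simp only:)
  qed
  also have "\<dots> \<le> 4 ^ r / 2 * C ^ (r * s + 1) * c ^ ((r - 1) * e)"
  proof (intro mult_mono)
    have "(4::real) ^ r = 4 * 4 ^ (r - 1)" using r by (simp add: power_eq_if)
    then show "2 * 4 ^ (r - 1) \<le> (4::real) ^ r / 2" by simp
    show "c ^ ((r - 1) * (2 * t)) \<le> c ^ ((r - 1) * e)"
      using c e1 by (intro power_increasing mult_le_mono) auto
  qed (use C c in auto)
  finally have "M ^ (r * (e + 1)) \<le> 4 ^ r / 2 * C ^ (r * s + 1)"
    using c by (simp add: mult_le_cancel_right_pos)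
  moreover have "M ^ (r * ((r - 3) * s)) \<le> M ^ (r * (e + 1))"
    by (rule power_increasing[OF mult_le_mono2[OF e1(1)] M])
  moreover have "(4::real) ^ r / 2 * C ^ (r * s + 1) < 4 ^ (r * s) * C ^ (2 * (r * s))"
  proof -
    have "(4::real) ^ r \<le> 4 ^ (r * s)" using t by (intro power_increasing) auto
    moreover have "C ^ (r * s + 1) \<le> C ^ (2 * (r * s))" using C t r by (intro power_increasing) auto
    ultimately have "(4::real) ^ r * C ^ (r * s + 1) \<le> 4 ^ (r * s) * C ^ (2 * (r * s))"
      using C by (intro mult_mono) auto
    moreover have "0 < (4::real) ^ r * C ^ (r * s + 1)" using C by simp
    ultimately show ?thesis by linarith
  qed
  ultimately have "M ^ (r * ((r - 3) * s)) < 4 ^ (r * s) * C ^ (2 * (r * s))" by linarith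
  moreover have "M ^ (r * ((r - 3) * s)) = (M ^ (r - 3)) ^ (r * s)"
    by (simp add: power_mult[symmetric] mult_ac)
  moreover have "(4 * C ^ 2) ^ (r * s) = 4 ^ (r * s) * C ^ (2 * (r * s))"
    by (simp add: power_mult_distrib power_mult)
  moreover have "(4 * C ^ 2) ^ (r * s) \<le> (M ^ (r - 3)) ^ (r * s)"
    using big C by (intro power_mono) auto
  ultimately show False by simp
qed

text \<open>
  The second solution plays the role of \<open>(X1, Y1)\<close> in the hypergeometric inequality and the third one
  that of \<open>(X2, Y2)\<close>. For each \<open>n\<close>, at least one of the approximants \<open>n\<close> and \<open>n + 1\<close> gives a nonzero
  integer \<open>N\<close>; the estimate \<open>ineq\<close> is weak enough to follow in both cases.
\<close>

lemma no_three_congruent_solutions: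
  fixes a b c r :: nat and x1 y1 x2 y2 x3 y3 :: int
  defines "S \<equiv> primitive_positive_solutions a b c r"
  defines "M \<equiv> root r (real (a * b))"
  assumes a: "a > 0" and b: "b > 0" and c: "c > 0" and r: "r \<ge> 5"
    and big: "M ^ (r - 3) \<ge> 256 * real r ^ 4"
    and S: "(x1, y1) \<in> S" "(x2, y2) \<in> S" "(x3, y3) \<in> S"
    and lt: "x1 < x2" "x2 < x3"
    and cl: "int c dvd x1 * y2 - x2 * y1" "int c dvd x2 * y3 - x3 * y2"
  shows False
proof -
  define X Y where "X x = root r (real a) * of_int x" and "Y y = root r (real b) * of_int y"
    for x y :: int
  have r0: "r > 0" using r by simp
  have M: "M = root r (real a) * root r (real b)" by (simp add: M_def real_root_mult)
  have ra: "root r (real a) \<ge> 1" and rb: "root r (real b) \<ge> 1" using a b r0 by auto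
  have sol: "1 \<le> Y y" "Y y \<le> X x" "X x ^ r - Y y ^ r = of_int (int c)" "0 < x" "0 < y"
    if "(x, y) \<in> S" for x y
  proof -
    have xy: "0 < x" "0 < y" and eq: "int a * x ^ r - int b * y ^ r = int c"
      using that by (auto simp: S_def primitive_positive_solutions_def)
    show "0 < x" "0 < y" by (fact xy)+
    have y1: "1 \<le> real_of_int y" using xy by simp
    have "1 * 1 \<le> root r (real b) * of_int y" using rb y1 by (intro mult_mono) auto
    then show Y1: "1 \<le> Y y" by (simp add: Y_def)
    have "X x ^ r - Y y ^ r = real a * of_int x ^ r - real b * of_int y ^ r"
      using r0 by (simp add: X_def Y_def power_mult_distrib)
    also have "\<dots> = of_int (int a * x ^ r - int b * y ^ r)" by simp
    finally show XY: "X x ^ r - Y y ^ r = of_int (int c)" by (simp only: eq)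
    have "0 \<le> X x" using ra xy by (simp add: X_def)
    moreover have "Y y ^ r \<le> X x ^ r" using XY c by linarith
    ultimately show "Y y \<le> X x" using Y1 r0 by (simp add: power_mono_iff)
  qed
  have X_mono: "X x \<le> X x'" if "x < x'" for x x' using that ra by (simp add: X_def)
  have cross: "X x * Y y' - X x' * Y y = M * of_int (x * y' - x' * y)" for x y x' y'
    by (simp add: X_def Y_def M algebra_simps)
  have M1: "M > 1"
  proof (rule ccontr)
    assume "\<not> M > 1"
    moreover have "M \<ge> 0" unfolding M_def by (rule real_root_ge_zero) simp
    ultimately have "M ^ (r - 3) \<le> 1" by (intro power_le_one) auto
    moreover have "(1::real) \<le> real r ^ 4" using r by (intro one_le_power) auto
    ultimately show False using big by linarith
  qed
  have gap: "M * X x ^ (r - 1) \<le> X x'"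
    if s: "(x, y) \<in> S" "(x', y') \<in> S" and l: "x < x'" and d: "int c dvd x * y' - x' * y" for x y x' y'
  proof (rule gap_principle_real[OF sol(1-3)[OF s(1)] sol(1-3)[OF s(2)] X_mono[OF l]])
    have "x * y' \<noteq> x' * y"
    proof
      assume e: "x * y' = x' * y"
      have g: "coprime x y" "coprime x' y'"
        using s by (auto simp: S_def primitive_positive_solutions_def primitive_def coprime_iff_gcd_eq_1)
      have "x' dvd x * y'" unfolding e by simp
      then have "x' dvd x" using g by (simp add: coprime_dvd_mult_left_iff)
      then have "x' \<le> x" using sol(4)[OF s(1)] by (rule zdvd_imp_le)
      then show False using l by simp
    qed
    then have "x * y' - x' * y \<noteq> 0" by simp
    then have "int c \<le> \<bar>x * y' - x' * y\<bar>" using dvd_imp_le_int[OF _ d] by simp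
    then show "of_int (int c) \<le> \<bar>real_of_int (x * y' - x' * y)\<bar>" by linarith
  qed (use cross M1 c r in auto)
  define W where "W = X x2"
  have W1: "W \<ge> 1" using sol(1,2)[OF S(2)] by (simp add: W_def)
  have Mr: "M ^ r \<ge> 256 * real r ^ 4"
  proof -
    have "M ^ (r - 3) \<le> M ^ r" using M1 by (intro power_increasing) auto
    then show ?thesis using big by linarith
  qed
  have c1: "real c \<ge> 1" using c by simp
  \<comment> \<open>The gap to the first solution, combined with \<open>X^r \<ge> c\<close> for that solution.\<close>
  have Wr: "W ^ r \<ge> M ^ r * real c ^ (r - 1)"
  proof -
    have X1: "0 \<le> X x1" and Xc: "real c \<le> X x1 ^ r"
      using sol(1-3)[OF S(1)] zero_le_power[of "Y y1" r] by (linarith, simp only: of_int_of_nat_eq, linarith)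
    have "M ^ r * real c ^ (r - 1) \<le> M ^ r * (X x1 ^ r) ^ (r - 1)"
      using M1 Xc by (intro mult_left_mono power_mono) auto
    also have "\<dots> = (M * X x1 ^ (r - 1)) ^ r"
      by (simp add: power_mult_distrib power_mult[symmetric] mult.commute)
    also have "\<dots> \<le> W ^ r"
      unfolding W_def using gap[OF S(1,2) lt(1) cl(1)] M1 X1 by (intro power_mono) auto
    finally show ?thesis .
  qed
  have r4: "real r ^ 4 \<ge> real r ^ 2" "real r ^ 2 \<ge> 1"
    using r by (auto intro!: power_increasing one_le_power)
  have Wc2: "256 * real r ^ 2 * real c ^ 2 \<le> W ^ r"
  proof -
    have "256 * real r ^ 2 \<le> M ^ r" using Mr r4 by linarith
    then have "256 * real r ^ 2 * real c ^ 2 \<le> M ^ r * real c ^ (r - 1)"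
      using M1 c1 r by (intro mult_mono power_increasing) auto
    with Wr show ?thesis by linarith
  qed
  have c2: "real c \<le> real c ^ 2" "0 < real c ^ 2" using c1 by (auto simp: power2_eq_square)
  have r2c2: "1 * real c ^ 2 \<le> real r ^ 2 * real c ^ 2" using r4 by (intro mult_right_mono) auto
  have small: "2 * of_int (int c) \<le> X x2 ^ r" and cW: "real c ^ 2 \<le> W ^ r"
    and ratio: "8 * real r ^ 2 * real c ^ 2 < W ^ r"
    using Wc2 r2c2 c2 unfolding W_def of_int_of_nat_eq by linarith+
  define w where "w = int a * x2 ^ r"
  have w: "w \<noteq> 0" "real_of_int w = X x2 ^ r"
    using a r0 sol(4)[OF S(2)] by (simp_all add: w_def X_def power_mult_distrib)
  let ?C = "8 * real r ^ 2"
  have C1: "?C \<ge> 1" using r4 by simp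
  have ineq: "M \<le> 2 * ?C ^ (n + 1) * real c ^ (2 * n) * W * X x3 / W ^ (r * (n + 1))
                 + ?C ^ (n + 1) * W ^ (r * (n + 1) + 1) / X x3 ^ (r - 1)" for n
  proof -
    obtain P Q where PQ:
      "of_int P = real r ^ (2 * n) * (X x2 ^ r) ^ n * poly (pade_num (1 / real r) n) (of_int (int c) / X x2 ^ r)"
      "of_int Q = real r ^ (2 * n) * (X x2 ^ r) ^ n * poly (pade_den (1 / real r) n) (of_int (int c) / X x2 ^ r)"
      "int c dvd P - Q"
      using pade_homogenised[OF r0 w(1), of n "int c"] unfolding w(2) by blast
    obtain P' Q' where PQ':
      "of_int P' = real r ^ (2 * Suc n) * (X x2 ^ r) ^ Suc n * poly (pade_num (1 / real r) (Suc n)) (of_int (int c) / X x2 ^ r)"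
      "of_int Q' = real r ^ (2 * Suc n) * (X x2 ^ r) ^ Suc n * poly (pade_den (1 / real r) (Suc n)) (of_int (int c) / X x2 ^ r)"
      "int c dvd P' - Q'"
      using pade_homogenised[OF r0 w(1), of "Suc n" "int c"] unfolding w(2) by blast
    \<comment> \<open>Two linear forms with nonzero determinant cannot both vanish at \<open>(x2 y3, y2 x3)\<close>.\<close>
    have det: "P' * Q \<noteq> P * Q'"
    proof
      assume "P' * Q = P * Q'"
      then have "real_of_int P' * of_int Q = of_int P * of_int Q'" by (metis of_int_mult)
      moreover have "X x2 \<noteq> 0" "r \<noteq> 0" using W1 r0 by (auto simp: W_def)
      ultimately have "poly (pade_num (1 / real r) (Suc n)) (of_int (int c) / X x2 ^ r) * poly (pade_den (1 / real r) n) (of_int (int c) / X x2 ^ r)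
        = poly (pade_num (1 / real r) n) (of_int (int c) / X x2 ^ r) * poly (pade_den (1 / real r) (Suc n)) (of_int (int c) / X x2 ^ r)"
        unfolding PQ PQ' by (simp add: mult_ac)
      moreover have "of_int (int c) / X x2 ^ r \<noteq> 0" using c w by (simp add: w(2)[symmetric])
      ultimately show False using pade_determinant[of "1 / real r"] r by fastforce
    qed
    define N where "N p q = x2 * p * y3 - y2 * q * x3" for p q
    have N_eq: "X x2 * of_int p * Y y3 - Y y2 * of_int q * X x3 = M * of_int (N p q)" for p q
      by (simp add: N_def X_def Y_def M algebra_simps)
    have N_dvd: "int c dvd N p q" if "int c dvd p - q" for p q
    proof -
      have "N p q = x2 * y3 * (p - q) + q * (x2 * y3 - x3 * y2)" by (simp add: N_def algebra_simps)
      then show ?thesis using that cl(2) by simp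
    qed
    have nz: "N P Q \<noteq> 0 \<or> N P' Q' \<noteq> 0"
    proof (rule ccontr)
      assume "\<not> ?thesis"
      then have e: "x2 * y3 * P = y2 * x3 * Q" "x2 * y3 * P' = y2 * x3 * Q'"
        by (simp_all add: N_def algebra_simps)
      have "x2 * y3 * (P * Q') = (x2 * y3 * P) * Q'" by (simp only: mult_ac)
      also have "\<dots> = (y2 * x3 * Q') * Q" unfolding e(1) by (simp only: mult_ac)
      also have "\<dots> = x2 * y3 * (P' * Q)" unfolding e(2)[symmetric] by (simp only: mult_ac)
      finally have "x2 * y3 * (P * Q') = x2 * y3 * (P' * Q)" .
      then show False using det sol(4)[OF S(2)] sol(5)[OF S(3)] by simp
    qed
    note H = hypergeometric_inequality[OF sol(1-3)[OF S(2)] sol(1-3)[OF S(3)] _ _ _ small _ _ N_eq N_dvd]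
    have X3: "X x3 > 0" using sol(1,2)[OF S(3)] by linarith
    from nz show ?thesis
    proof
      assume "N P Q \<noteq> 0"
      then have "M \<le> 2 * ?C ^ n * real c ^ (2 * n) * W * X x3 / W ^ (r * (n + 1))
            + ?C ^ n * W ^ (r * n + 1) / X x3 ^ (r - 1)"
        using H[OF _ _ _ PQ(1,2) PQ(3)] r c M1 by (simp add: W_def)
      also have "\<dots> \<le> 2 * ?C ^ (n + 1) * real c ^ (2 * n) * W * X x3 / W ^ (r * (n + 1))
                 + ?C ^ (n + 1) * W ^ (r * (n + 1) + 1) / X x3 ^ (r - 1)"
        using C1 W1 X3 c1
        by (intro add_mono divide_right_mono mult_right_mono mult_mono power_increasing) auto
      finally show ?thesis .
    next
      assume "N P' Q' \<noteq> 0"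
      then have "M \<le> 2 * ?C ^ Suc n * real c ^ (2 * Suc n) * W * X x3 / W ^ (r * (Suc n + 1))
            + ?C ^ Suc n * W ^ (r * Suc n + 1) / X x3 ^ (r - 1)"
        using H[OF _ _ _ PQ'(1,2) PQ'(3)] r c M1 by (simp add: W_def)
      also have "2 * ?C ^ Suc n * real c ^ (2 * Suc n) * W * X x3 / W ^ (r * (Suc n + 1))
          = (2 * ?C ^ (n + 1) * real c ^ (2 * n) * W * X x3 / W ^ (r * (n + 1))) * (real c ^ 2 / W ^ r)"
      proof -
        have "real c ^ (2 * Suc n) = real c ^ (2 * n) * real c ^ 2" 
          by (simp flip: power_add)
        moreover have "W ^ (r * (Suc n + 1)) = W ^ (r * (n + 1)) * W ^ r"
          by (simp add: algebra_simps flip: power_add)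
        ultimately show ?thesis by (simp add: power2_eq_square)
      qed
      also have "\<dots> \<le> (2 * ?C ^ (n + 1) * real c ^ (2 * n) * W * X x3 / W ^ (r * (n + 1))) * 1"
        using cW W1 X3 by (intro mult_left_mono) auto
      finally show ?thesis by simp
    qed
  qed
  show False
  proof (rule sizes_contradict_approximation_inequalities[OF r c1 _ C1 _ Wr _ ratio _ ineq])
    show "M * W ^ (r - 1) \<le> X x3" unfolding W_def by (rule gap[OF S(2,3) lt(2) cl(2)])
    show "4 * ?C ^ 2 \<le> M ^ (r - 3)" using big by (simp add: power_mult_distrib)
  qed (use M1 W1 in auto)
qed

text \<open>
  The bound on \<open>a b\<close> says that \<open>M \<ge> 2 r^(7/(r-4))\<close>, so \<open>M^(r-3)\<close> is at least
  \<open>2^(r-3) r^7 \<ge> 4 r^3 r^4\<close>, and \<open>r^3 \<ge> 125\<close>.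
\<close>

lemma at_most_two_solutions_per_class:
  fixes a b c r :: nat
  assumes a: "a > 0" and b: "b > 0" and c: "c > 0" and r: "r \<ge> 5" and cop: "gcd c (r * a * b) = 1"
    and ab: "real (a * b) \<ge> 2 ^ r * real r powr (7 * real r / (real r - 4))"
  shows "at_most (primitive_positive_solutions a b c r) (2 * r ^ omega c)"
proof -
  define M where "M = root r (real (a * b))"
  have r0: "r > 0" "real r \<ge> 5" using r by auto
  define B where "B = 2 * real r powr (7 / (real r - 4))"
  have "B ^ r = 2 ^ r * (real r powr (7 / (real r - 4))) ^ r" by (simp add: B_def power_mult_distrib)
  also have "(real r powr (7 / (real r - 4))) ^ r = real r powr (7 * real r / (real r - 4))"
    using r0 by (simp add: powr_realpow[symmetric] powr_powr)
  finally have "B ^ r \<le> M ^ r" using ab r0 by (simp add: M_def)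
  moreover have "M \<ge> 0" unfolding M_def by (rule real_root_ge_zero) simp
  ultimately have BM: "B \<le> M" using power_le_imp_le_base[of B "r - 1" M] r0 by simp
  have B0: "B \<ge> 0" by (simp add: B_def)
  have big: "256 * real r ^ 4 \<le> M ^ (r - 3)"
  proof -
    have "256 * real r ^ 4 \<le> 4 * (real r ^ 3 * real r ^ 4)"
    proof -
      have "(5::real) ^ 3 \<le> real r ^ 3" using r0 by (intro power_mono) auto
      then have "64 * real r ^ 4 \<le> real r ^ 3 * real r ^ 4" by (intro mult_right_mono) auto
      then show ?thesis by simp
    qed
    also have "\<dots> = 2 ^ 2 * real r powr 7" using r0 by (simp flip: power_add add: powr_numeral)
    also have "\<dots> \<le> 2 ^ (r - 3) * (real r powr (7 / (real r - 4))) ^ (r - 3)"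
    proof (intro mult_mono)
      show "(2::real) ^ 2 \<le> 2 ^ (r - 3)" using r by (intro power_increasing) auto
      have "7 \<le> 7 / (real r - 4) * real (r - 3)" using r0 r by (simp add: field_simps of_nat_diff)
      then have "real r powr 7 \<le> real r powr (7 / (real r - 4) * real (r - 3))"
        using r0 by (intro powr_mono) auto
      also have "\<dots> = (real r powr (7 / (real r - 4))) ^ (r - 3)"
        using r0 by (simp add: powr_powr flip: powr_realpow)
      finally show "real r powr 7 \<le> (real r powr (7 / (real r - 4))) ^ (r - 3)" .
    qed auto
    also have "\<dots> = B ^ (r - 3)" by (simp add: B_def power_mult_distrib)
    also have "\<dots> \<le> M ^ (r - 3)" using BM B0 by (rule power_mono)
    finally show ?thesis .
  qed
  show ?thesis
    using no_three_congruent_solutions[OF a b c r big[unfolded M_def]]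
    by (intro at_most_if_no_three_congruent_solutions[OF c r0(1) cop _ b]) blast
qed

theorem theorem1p2:
  fixes a b c r :: nat
  assumes "a > 0" and "b > 0" and "c > 0" and "r \<ge> 5"
    and "gcd c (r * a * b) = 1"
  shows "(real (a * b) \<ge> 2 ^ r * real r powr (182.6 * real r / (real r - 1)) \<longrightarrow>
            at_most (primitive_positive_solutions a b c r) (2 * r ^ omega c)) \<and>
         (real (a * b) \<ge> 2 ^ r * real r powr (7 * real r / (real r - 4)) \<longrightarrow>
            at_most (primitive_positive_solutions a b c r) (3 * r ^ omega c))"
proof (intro conjI impI)
  note two = at_most_two_solutions_per_class[OF assms]
  have r: "real r \<ge> 5" using assms(4) by simp
  {
    assume ab: "real (a * b) \<ge> 2 ^ r * real r powr (182.6 * real r / (real r - 1))"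
    have "7 * (real r - 1) \<le> 182.6 * (real r - 4)" using r by simp
    then have "7 / (real r - 4) \<le> 182.6 / (real r - 1)" using r by (simp add: field_simps)
    then have "7 / (real r - 4) * real r \<le> 182.6 / (real r - 1) * real r" by (intro mult_right_mono) auto
    then have "real r powr (7 * real r / (real r - 4)) \<le> real r powr (182.6 * real r / (real r - 1))"
      using r by (intro powr_mono) (simp_all only: times_divide_eq_left)
    then have "2 ^ r * real r powr (7 * real r / (real r - 4))
        \<le> 2 ^ r * real r powr (182.6 * real r / (real r - 1))" by simp
    with ab have "real (a * b) \<ge> 2 ^ r * real r powr (7 * real r / (real r - 4))" by linarith
    then show "at_most (primitive_positive_solutions a b c r) (2 * r ^ omega c)" by (rule two)
  }
  assume "real (a * b) \<ge> 2 ^ r * real r powr (7 * real r / (real r - 4))"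
  then have "at_most (primitive_positive_solutions a b c r) (2 * r ^ omega c)" by (rule two)
  then show "at_most (primitive_positive_solutions a b c r) (3 * r ^ omega c)"
    unfolding at_most_def by linarith
qed

end
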